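(* Let $d\ge 2$, let $v_1,\ldots,v_n\in\mathbb{R}^d$, $x^0\in\mathbb{R}^n$, and let $P(x^0)=\{p\in\mathbb{R}^d\mid v_i^\top p\le x^0_i\text{ for all }i\}$ be a $d$-dimensional convex polytope with outer facet normals $v_1,\ldots,v_n$ and support parameters $x_1^0,\ldots,x_n^0$. Let $\lambda_1$ be the (unique, simple) negative eigenvalue of the matrix $M$ with entries $$M_{ij}=-\left.\frac{\partial^2\mathrm{vol}_d(P(x))}{\partial x_i\,\partial x_j}\right|_{x=x^0}.$$ Then $$\lambda_1\le -d(d-1)\cdot\frac{\mathrm{vol}_d(P(x^0))}{\|x^0\|^2}.$$ Equality takes place if and only if there is a constant $c$ such that $$x_i^0=c\cdot\frac{\mathrm{vol}_{d-1}(F_i(x^0))}{\|v_i\|}\quad\text{for all } i.$$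
   Context: For $x\in\mathbb{R}^n$ put $P(x)=\{p\in\mathbb{R}^d\mid v_i^\top p\le x_i\text{ for all }i\}$ and $F_i(x)=\{p\in P(x)\mid v_i^\top p=x_i\}$. Saying that $P(x)$ has outer facet normals $v_1,\ldots,v_n$ means that $P(x)$ is a $d$-dimensional polytope, each $F_i(x)$ is a facet (a $(d-1)$-dimensional face), and these facets are distinct for distinct $i$; the $v_i$ are nonzero but need not be unit vectors. The set of such $x$ is open in $\mathbb{R}^n$ and $\mathrm{vol}_d(P(x))$ is twice continuously differentiable on it. The matrix $M$ has exactly one negative eigenvalue, which is simple. $\|\cdot\|$ is the Euclidean norm, and $\mathrm{vol}_k$ is $k$-dimensional volume. *)

theory Defs
  imports "HOL-Analysis.Analysis" "HOL-Computational_Algebra.Polynomial"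
begin

definition poly_P :: "('n::finite \<Rightarrow> real^'d) \<Rightarrow> real^'n \<Rightarrow> (real^'d) set" where
  "poly_P v x = {p. \<forall>i. v i \<bullet> p \<le> x $ i}"

definition face_F :: "('n::finite \<Rightarrow> real^'d) \<Rightarrow> 'n \<Rightarrow> real^'n \<Rightarrow> (real^'d) set" where
  "face_F v i x = {p \<in> poly_P v x. v i \<bullet> p = x $ i}"

definition has_outer_facet_normals :: "('n::finite \<Rightarrow> real^'d) \<Rightarrow> real^'n \<Rightarrow> bool" where
  "has_outer_facet_normals v x \<longleftrightarrow>
     polytope (poly_P v x) \<and> aff_dim (poly_P v x) = int CARD('d) \<and>
     (\<forall>i. v i \<noteq> 0) \<and>
     (\<forall>i. face_F v i x facet_of poly_P v x) \<and>
     inj (\<lambda>i. face_F v i x)"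

definition orthonormal_frame :: "nat \<Rightarrow> (nat \<Rightarrow> 'a::euclidean_space) \<Rightarrow> bool" where
  "orthonormal_frame k b \<longleftrightarrow> (\<forall>i<k. \<forall>j<k. b i \<bullet> b j = (if i = j then 1 else 0))"

definition flat_point :: "nat \<Rightarrow> 'a::euclidean_space \<Rightarrow> (nat \<Rightarrow> 'a) \<Rightarrow> (nat \<Rightarrow> real) \<Rightarrow> 'a" where
  "flat_point k a b y = a + (\<Sum>i<k. y i *\<^sub>R b i)"

text \<open>
  The \<open>k\<close>-dimensional volume of a Borel set \<open>A\<close> lying in some \<open>k\<close>-dimensional affine subspace:
  the \<open>k\<close>-dimensional Lebesgue measure of \<open>A\<close> after identifying that subspace isometrically with
  \<open>k\<close>-dimensional coordinate space (functions on \<open>{..<k}\<close>).  By invariance of Lebesgue measure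
  under isometries the value does not depend on the isometry chosen.  It is unspecified for sets
  that lie in no \<open>k\<close>-dimensional affine subspace.
\<close>
definition flat_volume :: "nat \<Rightarrow> 'a::euclidean_space set \<Rightarrow> real" where
  "flat_volume k A = (SOME m. \<exists>a b.
     orthonormal_frame k b \<and> A \<subseteq> range (flat_point k a b) \<and>
     m = measure (Pi\<^sub>M {..<k} (\<lambda>_. lborel))
           {y \<in> space (Pi\<^sub>M {..<k} (\<lambda>_. lborel)). flat_point k a b y \<in> A})"

definition partial_deriv :: "'n::finite \<Rightarrow> (real^'n \<Rightarrow> real) \<Rightarrow> real^'n \<Rightarrow> real" where
  "partial_deriv i f x = deriv (\<lambda>t. f (x + t *\<^sub>R axis i 1)) 0"

definition is_eigenvalue :: "real^'n^'n \<Rightarrow> real \<Rightarrow> bool" where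
  "is_eigenvalue A l \<longleftrightarrow> (\<exists>w. w \<noteq> 0 \<and> A *v w = l *\<^sub>R w)"

definition charpoly :: "real^'n^'n \<Rightarrow> real poly" where
  "charpoly A = det (\<chi> i j. (if i = j then [:0, 1:] else 0) - [:A $ i $ j:])"

definition is_simple_eigenvalue :: "real^'n^'n \<Rightarrow> real \<Rightarrow> bool" where
  "is_simple_eigenvalue A l \<longleftrightarrow> is_eigenvalue A l \<and> order l (charpoly A) = 1"

end

theory Submission
  imports Defs
begin

text \<open>
  Write \<open>V\<close> for the volume of \<open>P(x)\<close>, a homogeneous function of degree \<open>d\<close>, and \<open>G\<close> for its gradient
  at \<open>x\<^sup>0\<close>, so that \<open>G\<^sub>i = vol(F\<^sub>i) / \<parallel>v\<^sub>i\<parallel>\<close>. Euler's identity for \<open>V\<close> and for its partial derivatives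
  gives \<open>M x\<^sup>0 = -(d - 1) G\<close> and \<open>x\<^sup>0 \<bullet> M x\<^sup>0 = -d (d - 1) V\<close>. Since \<open>M\<close> is symmetric, its only negative
  eigenvalue is the minimum of the Rayleigh quotient; the bound is the value of that quotient at \<open>x\<^sup>0\<close>,
  and it is attained iff \<open>x\<^sup>0\<close> is an eigenvector, i.e. proportional to \<open>G\<close>.

  Regularity of \<open>V\<close> comes from slicing: in an orthonormal frame whose last vector is normal to a facet,
  Fubini exhibits the partial derivative of \<open>V\<close> as the \<open>(d - 1)\<close>-volume of a polyhedron given by the
  remaining inequalities, and slicing once more yields the mixed second derivatives. Dominated
  convergence makes these volumes continuous as long as no inequality degenerates to \<open>0 \<le> 0\<close> on the
  slice, which the facet hypothesis excludes.
\<close>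

section \<open>Volumes of polyhedra in coordinates\<close>

text \<open>Since \<open>partial_deriv\<close> rests on \<open>deriv\<close>, its value means
  something only where the derivative exists. Existence must therefore be proved, for first
  derivatives even in a whole neighbourhood of \<open>x0\<close>, while the facet hypothesis speaks
  of one point. That hypothesis is traded for inequations between support parameters
  (\<open>slice_nondeg\<close>, \<open>slice2_nondeg\<close>) that persist nearby as far as needed,
  so the face structure of neighbouring polyhedra need not be followed. Boundedness is traded
  likewise for an estimate that depends on the normals alone.

  Euler's identity for a partial derivative also involves the pure second derivatives, which slicing
  twice along one normal cannot give; translation invariance supplies them. Of each mixed derivative
  only one order needs a formula: Schwarz's theorem yields the other, and with it the symmetry of
  \<open>M\<close>.

  \<open>flat_volume\<close> picks an arbitrary isometric parametrisation, so independence of that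
  choice is part of the proof.\<close>

abbreviation coord_lborel :: "nat \<Rightarrow> (nat \<Rightarrow> real) measure" where
  "coord_lborel m \<equiv> Pi\<^sub>M {..<m} (\<lambda>_. lborel)"

text \<open>The dimension is a number and not a type because each slicing lowers it by one and drops
  one row index; \<open>A\<close> stays the same throughout, its columns from \<open>m\<close> on
  merely going out of use.\<close>

definition ineq_set :: "nat \<Rightarrow> 'k set \<Rightarrow> ('k \<Rightarrow> nat \<Rightarrow> real) \<Rightarrow> ('k \<Rightarrow> real) \<Rightarrow> (nat \<Rightarrow> real) set" where
  "ineq_set m I A x = {y \<in> space (coord_lborel m). \<forall>k\<in>I. (\<Sum>l<m. A k l * y l) \<le> x k}"

definition ineq_vol :: "nat \<Rightarrow> 'k set \<Rightarrow> ('k \<Rightarrow> nat \<Rightarrow> real) \<Rightarrow> ('k \<Rightarrow> real) \<Rightarrow> real" where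
  "ineq_vol m I A x = measure (coord_lborel m) (ineq_set m I A x)"

text \<open>Boundedness of all polyhedra with rows \<open>A\<close>, uniformly in the right-hand
  sides: the size is linear in \<open>B\<close> by homogeneity, and \<open>C\<close> depends on the
  rows only.\<close>

definition bounding :: "nat \<Rightarrow> 'k set \<Rightarrow> ('k \<Rightarrow> nat \<Rightarrow> real) \<Rightarrow> real \<Rightarrow> bool" where
  "bounding m I A C \<longleftrightarrow> (\<forall>q B. B > 0 \<longrightarrow> (\<forall>k\<in>I. (\<Sum>l<m. A k l * q l) \<le> B) \<longrightarrow> (\<forall>l<m. \<bar>q l\<bar> \<le> C * B))"

interpretation lborel_coords: product_sigma_finite "\<lambda>_::nat. lborel :: real measure" by standard

lemma sets_ineq_set [measurable, simp]:
  "finite I \<Longrightarrow> ineq_set m I A x \<in> sets (coord_lborel m)"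
  unfolding ineq_set_def by measurable

lemma ineq_set_cong:
  assumes "\<And>k l. k \<in> I \<Longrightarrow> l < m \<Longrightarrow> A k l = A' k l" "\<And>k. k \<in> I \<Longrightarrow> x k = x' k"
  shows "ineq_set m I A x = ineq_set m I A' x'"
  unfolding ineq_set_def using assms by simp

text \<open>Padding \<open>q\<close> with 0 in coordinate \<open>m\<close> makes row
  \<open>i\<close> vanish and leaves the other rows unchanged, so a slice inherits the same
  constant.\<close>

lemma bounding_step:
  assumes "bounding (Suc m) I A C" "\<And>l. l < m \<Longrightarrow> A i l = 0"
  shows "bounding m (I - {i}) A C"
  unfolding bounding_def
proof (intro allI impI)
  fix q :: "nat \<Rightarrow> real" and B :: real and l
  assume B: "B > 0" and q: "\<forall>k\<in>I - {i}. (\<Sum>l<m. A k l * q l) \<le> B" and l: "l < m"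
  have "(\<Sum>l<Suc m. A k l * (q(m:=0)) l) \<le> B" if "k \<in> I" for k
    using q B that assms(2) by (cases "k = i") auto
  then have "\<forall>l<Suc m. \<bar>(q(m:=0)) l\<bar> \<le> C * B"
    using assms(1) B unfolding bounding_def by blast
  then show "\<bar>q l\<bar> \<le> C * B" using l by (auto dest: spec[of _ l])
qed

section \<open>Finiteness and continuity of the volume in the right-hand sides\<close>

definition coord_cube :: "nat \<Rightarrow> real \<Rightarrow> (nat \<Rightarrow> real) set" where
  "coord_cube m R = Pi\<^sub>E {..<m} (\<lambda>_. {-R..R})"

lemma coord_cube_sets [measurable, simp]: "coord_cube m R \<in> sets (coord_lborel m)"
  unfolding coord_cube_def by (intro sets_PiM_I_finite) auto

lemma emeasure_coord_cube: "emeasure (coord_lborel m) (coord_cube m R) < \<infinity>"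
proof -
  have "emeasure (coord_lborel m) (coord_cube m R) = (\<Prod>i<m. emeasure lborel {-R..R})"
    unfolding coord_cube_def by (intro lborel_coords.emeasure_PiM) auto
  also have "\<dots> < \<infinity>"
    by (simp add: emeasure_lborel_Icc_eq ennreal_power power_less_top_ennreal)
  finally show ?thesis .
qed

lemma ineq_set_subset_cube:
  assumes "bounding m I A C" "B > 0" "\<And>k. k \<in> I \<Longrightarrow> x k \<le> B"
  shows "ineq_set m I A x \<subseteq> coord_cube m (C * B)"
proof
  fix y assume y: "y \<in> ineq_set m I A x"
  then have "\<forall>k\<in>I. (\<Sum>l<m. A k l * y l) \<le> B"
    using assms(3) unfolding ineq_set_def by force
  then have "\<forall>l<m. \<bar>y l\<bar> \<le> C * B" using assms unfolding bounding_def by blast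
  moreover have "y \<in> extensional {..<m}" using y by (auto simp: ineq_set_def space_PiM PiE_def)
  ultimately show "y \<in> coord_cube m (C * B)" unfolding coord_cube_def
    by (auto simp: PiE_iff abs_le_iff)
qed

lemma emeasure_ineq_set_finite:
  assumes "finite I" "bounding m I A C"
  shows "emeasure (coord_lborel m) (ineq_set m I A x) < \<infinity>"
proof -
  define B where "B = 1 + (\<Sum>k\<in>I. \<bar>x k\<bar>)"
  have B: "x k \<le> B" if "k \<in> I" for k
    using member_le_sum[OF that, of "\<lambda>k. \<bar>x k\<bar>"] assms(1) unfolding B_def by auto
  have "B > 0" unfolding B_def by (simp add: add_pos_nonneg sum_nonneg)
  then have "ineq_set m I A x \<subseteq> coord_cube m (C * B)"
    using ineq_set_subset_cube[OF assms(2)] B by blast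
  then have "emeasure (coord_lborel m) (ineq_set m I A x) \<le> emeasure (coord_lborel m) (coord_cube m (C * B))"
    by (intro emeasure_mono) auto
  then show ?thesis using emeasure_coord_cube le_less_trans by blast
qed

lemma emeasure_ineq_set:
  assumes "finite I" "bounding m I A C"
  shows "emeasure (coord_lborel m) (ineq_set m I A x) = ennreal (ineq_vol m I A x)"
  unfolding ineq_vol_def
  by (rule emeasure_eq_ennreal_measure) (use emeasure_ineq_set_finite[OF assms, of x] in auto)

text \<open>Fubini in coordinate \<open>j\<close>: every line in that direction meets the hyperplane
  in at most one point.\<close>

lemma AE_coord_not_hyperplane:
  assumes "j < m" "a j \<noteq> 0"
  shows "AE y in coord_lborel m. (\<Sum>l<m. a l * y l) \<noteq> (c::real)"
proof -
  let ?J = "{..<m} - {j}"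
  have ins: "insert j ?J = {..<m}" using assms by auto
  define S where "S = {y \<in> space (coord_lborel m). (\<Sum>l<m. a l * y l) = c}"
  have [measurable]: "S \<in> sets (coord_lborel m)" unfolding S_def by measurable
  have meas: "indicator S \<in> borel_measurable (Pi\<^sub>M (insert j ?J) (\<lambda>_. lborel))"
    unfolding ins by measurable
  have "emeasure (coord_lborel m) S = (\<integral>\<^sup>+y. indicator S y \<partial>Pi\<^sub>M (insert j ?J) (\<lambda>_. lborel))"
    unfolding ins by simp
  also have "\<dots> = (\<integral>\<^sup>+ y. (\<integral>\<^sup>+ s. indicator S (y(j := s)) \<partial>lborel) \<partial>(Pi\<^sub>M ?J (\<lambda>_. lborel)))"
    by (rule lborel_coords.product_nn_integral_insert) (use meas in auto)
  also have "\<dots> = (\<integral>\<^sup>+ y. 0 \<partial>(Pi\<^sub>M ?J (\<lambda>_. lborel :: real measure)))"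
  proof (rule nn_integral_cong)
    fix y :: "nat \<Rightarrow> real"
    let ?s = "(c - (\<Sum>l\<in>?J. a l * y l)) / a j"
    have "s = ?s" if "y(j:=s) \<in> S" for s
    proof -
      have "(\<Sum>l<m. a l * (y(j:=s)) l) = a j * s + (\<Sum>l\<in>?J. a l * y l)"
        using assms(1) by (subst sum.remove[of _ j]) (auto intro!: sum.cong)
      then show ?thesis using that assms(2) by (auto simp: S_def field_simps)
    qed
    then have "(\<integral>\<^sup>+ s. indicator S (y(j := s)) \<partial>lborel) \<le> (\<integral>\<^sup>+ s. indicator {?s} s \<partial>lborel)"
      by (intro nn_integral_mono) (auto simp: indicator_def)
    then show "(\<integral>\<^sup>+ s. indicator S (y(j := s)) \<partial>lborel) = 0" by simp
  qed
  finally have "S \<in> null_sets (coord_lborel m)" by (auto simp: null_sets_def)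
  then have "AE y in coord_lborel m. y \<notin> S" by (rule AE_not_in)
  then show ?thesis by (auto simp: S_def elim: AE_mp)
qed

text \<open>Off the finitely many bounding hyperplanes, membership is eventually constant along the
  sequence, and one cube dominates all the sets. A zero row has no null hyperplane;
  \<open>nondeg\<close> keeps its limiting bound away from 0, so that its truth value is eventually
  constant too.\<close>

lemma tendsto_ineq_vol:
  fixes X :: "nat \<Rightarrow> 'k \<Rightarrow> real"
  assumes fin: "finite I" and bd: "bounding m I A C"
    and lim: "\<And>k. k \<in> I \<Longrightarrow> (\<lambda>n. X n k) \<longlonglongrightarrow> x k"
    and nondeg: "\<And>k. k \<in> I \<Longrightarrow> (\<exists>l<m. A k l \<noteq> 0) \<or> x k \<noteq> 0"
  shows "(\<lambda>n. ineq_vol m I A (X n)) \<longlonglongrightarrow> ineq_vol m I A x"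
proof -
  have "\<exists>B. \<forall>n. X n k \<le> B" if "k \<in> I" for k
    using convergent_imp_Bseq[OF convergentI[OF lim[OF that]]]
    unfolding Bseq_def real_norm_def by (metis abs_le_D1)
  then have "\<forall>k\<in>I. \<exists>B. \<forall>n. X n k \<le> B" by blast
  from bchoice[OF this] obtain b where b: "\<And>k n. k \<in> I \<Longrightarrow> X n k \<le> b k" by blast
  \<comment> \<open>\<open>B\<close> exceeds every right-hand side of the whole sequence; the 1
    supplies the positivity required by \<open>bounding\<close>.\<close>
  define B where "B = 1 + (\<Sum>k\<in>I. \<bar>b k\<bar>)"
  have B: "X n k \<le> B" if "k \<in> I" for k n
    using b[OF that, of n] member_le_sum[OF that, of "\<lambda>k. \<bar>b k\<bar>"] fin unfolding B_def by auto
  have "B > 0" unfolding B_def by (simp add: add_pos_nonneg sum_nonneg)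
  let ?S = "\<lambda>x. ineq_set m I A x"
  have AE1: "AE y in coord_lborel m. \<forall>k\<in>I. (\<exists>l<m. A k l \<noteq> 0) \<longrightarrow> (\<Sum>l<m. A k l * y l) \<noteq> x k"
    using fin AE_coord_not_hyperplane by (intro AE_finite_allI) auto
  have "(\<lambda>n. integral\<^sup>L (coord_lborel m) (indicat_real (?S (X n)))) \<longlonglongrightarrow> integral\<^sup>L (coord_lborel m) (indicat_real (?S x))"
  proof (rule integral_dominated_convergence[where w="indicator (coord_cube m (C*B))"])
    show "AE y in coord_lborel m. (\<lambda>n. indicat_real (?S (X n)) y) \<longlonglongrightarrow> indicat_real (?S x) y"
      using AE1 AE_space
    proof eventually_elim
      fix y assume y: "\<forall>k\<in>I. (\<exists>l<m. A k l \<noteq> 0) \<longrightarrow> (\<Sum>l<m. A k l * y l) \<noteq> x k" "y \<in> space (coord_lborel m)"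
      have "\<forall>\<^sub>F n in sequentially. ((\<Sum>l<m. A k l * y l) \<le> X n k) = ((\<Sum>l<m. A k l * y l) \<le> x k)" if k: "k \<in> I" for k
      proof -
        have "(\<Sum>l<m. A k l * y l) \<noteq> x k"
        proof (cases "\<exists>l<m. A k l \<noteq> 0")
          case False
          then have "(\<Sum>l<m. A k l * y l) = 0" by (intro sum.neutral) auto
          then show ?thesis using nondeg[OF k] False by auto
        qed (use y k in auto)
        then consider "(\<Sum>l<m. A k l * y l) < x k" | "(\<Sum>l<m. A k l * y l) > x k" by linarith
        then show ?thesis
        proof cases
          case 1
          from order_tendstoD(1)[OF lim[OF k] 1] show ?thesis by eventually_elim (use 1 in auto)
        next
          case 2
          from order_tendstoD(2)[OF lim[OF k] 2] show ?thesis by eventually_elim (use 2 in auto)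
        qed
      qed
      then have "\<forall>\<^sub>F n in sequentially. \<forall>k\<in>I. ((\<Sum>l<m. A k l * y l) \<le> X n k) = ((\<Sum>l<m. A k l * y l) \<le> x k)"
        using fin by (intro eventually_ball_finite) auto
      then have "\<forall>\<^sub>F n in sequentially. indicat_real (?S (X n)) y = indicat_real (?S x) y"
        by eventually_elim (auto simp: ineq_set_def indicator_def)
      then show "(\<lambda>n. indicat_real (?S (X n)) y) \<longlonglongrightarrow> indicat_real (?S x) y"
        by (rule tendsto_eventually)
    qed
    show "integrable (coord_lborel m) (indicat_real (coord_cube m (C * B)))"
      using emeasure_coord_cube by (intro integrable_real_indicator) auto
    have "?S (X n) \<subseteq> coord_cube m (C*B)" for n
      using ineq_set_subset_cube[OF bd \<open>B > 0\<close>] B by blast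
    then show "AE y in coord_lborel m. norm (indicat_real (?S (X n)) y) \<le> indicat_real (coord_cube m (C * B)) y" for n
      by (intro AE_I2) (auto simp: indicator_def)
  qed (use fin in auto)
  then show ?thesis using fin by (simp add: ineq_vol_def)
qed

lemma isCont_ineq_vol:
  fixes X :: "'a::metric_space \<Rightarrow> 'k \<Rightarrow> real"
  assumes fin: "finite I" and bd: "bounding m I A C"
    and lim: "\<And>k. k \<in> I \<Longrightarrow> isCont (\<lambda>z. X z k) z0"
    and nondeg: "\<And>k. k \<in> I \<Longrightarrow> (\<exists>l<m. A k l \<noteq> 0) \<or> X z0 k \<noteq> 0"
  shows "isCont (\<lambda>z. ineq_vol m I A (X z)) z0"
  unfolding continuous_within tendsto_at_iff_sequentially comp_def
proof (intro allI impI)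
  fix Z assume Z: "\<forall>i. Z i \<in> UNIV - {z0}" "Z \<longlonglongrightarrow> z0"
  show "(\<lambda>n. ineq_vol m I A (X (Z n))) \<longlonglongrightarrow> ineq_vol m I A (X z0)"
    by (intro tendsto_ineq_vol[OF fin bd]) (use nondeg isCont_tendsto_compose[OF lim Z(2)] in auto)
qed

text \<open>Fubini in the last coordinate \<open>u\<close>. Row \<open>i\<close> involves
  \<open>u\<close> alone and becomes the upper limit of integration; the other rows keep their first
  \<open>m\<close> entries and have their bounds shifted.\<close>

lemma ineq_vol_Suc:
  assumes fin: "finite I" and bd: "bounding (Suc m) I A C"
    and i: "i \<in> I" "\<And>l. l < m \<Longrightarrow> A i l = 0" "A i m > 0"
  shows "ennreal (ineq_vol (Suc m) I A x) =
     (\<integral>\<^sup>+u. indicator {..x i / A i m} u * ennreal (ineq_vol m (I - {i}) A (\<lambda>k. x k - A k m * u)) \<partial>lborel)"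
proof -
  let ?S = "ineq_set (Suc m) I A x"
  have ins: "{..<Suc m} = insert m {..<m}" by auto
  have [measurable]: "?S \<in> sets (Pi\<^sub>M (insert m {..<m}) (\<lambda>_. lborel))"
    using sets_ineq_set[OF fin, of "Suc m"] by (simp add: ins)
  have "ennreal (ineq_vol (Suc m) I A x) = emeasure (coord_lborel (Suc m)) ?S"
    using emeasure_ineq_set[OF fin bd] by simp
  also have "\<dots> = (\<integral>\<^sup>+y. indicator ?S y \<partial>Pi\<^sub>M (insert m {..<m}) (\<lambda>_. lborel))"
    by (simp add: ins)
  also have "\<dots> = (\<integral>\<^sup>+u. (\<integral>\<^sup>+y. indicator ?S (y(m:=u)) \<partial>coord_lborel m) \<partial>lborel)"
    by (rule lborel_coords.product_nn_integral_insert_rev) auto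
  also have "\<dots> = (\<integral>\<^sup>+u. indicator {..x i / A i m} u * ennreal (ineq_vol m (I - {i}) A (\<lambda>k. x k - A k m * u)) \<partial>lborel)"
  proof (rule nn_integral_cong)
    fix u :: real
    let ?x = "\<lambda>k. x k - A k m * u"
    have "(\<integral>\<^sup>+y. indicator ?S (y(m:=u)) \<partial>coord_lborel m) =
        (\<integral>\<^sup>+y. indicator {..x i / A i m} u * indicator (ineq_set m (I-{i}) A ?x) y \<partial>coord_lborel m)"
    proof (rule nn_integral_cong)
      fix y assume y: "y \<in> space (coord_lborel m)"
      then have sp: "y(m:=u) \<in> space (coord_lborel (Suc m))"
        by (auto simp: space_PiM PiE_def extensional_def)
      have s: "(\<Sum>l<Suc m. A k l * (y(m:=u)) l) = (\<Sum>l<m. A k l * y l) + A k m * u" for k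
        by simp
      have "y(m:=u) \<in> ?S \<longleftrightarrow> (\<forall>k\<in>I. (\<Sum>l<m. A k l * y l) \<le> ?x k)"
        unfolding ineq_set_def s using sp by (auto simp: algebra_simps)
      also have "\<dots> \<longleftrightarrow> u \<in> {..x i / A i m} \<and> y \<in> ineq_set m (I-{i}) A ?x"
      proof -
        have "(\<Sum>l<m. A i l * y l) = 0" using i by auto
        then show ?thesis using i(1,3) y unfolding ineq_set_def by (auto simp: field_simps)
      qed
      finally show "indicator ?S (y(m:=u)) = (indicator {..x i / A i m} u * indicator (ineq_set m (I-{i}) A ?x) y :: ennreal)"
        by (auto simp: indicator_def)
    qed
    also have "\<dots> = indicator {..x i / A i m} u * ennreal (ineq_vol m (I - {i}) A ?x)"
      using fin by (simp add: nn_integral_cmult emeasure_ineq_set[OF _ bounding_step[OF bd i(2)]])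
    finally show "(\<integral>\<^sup>+y. indicator ?S (y(m:=u)) \<partial>coord_lborel m) = \<dots>" .
  qed
  finally show ?thesis .
qed

text \<open>The fundamental theorem of calculus with lower limit minus infinity, for an integrand
  continuous at \<open>c\<close> only. Finiteness of the integrals is contained in
  \<open>eq\<close>; increments appear as an additive splitting, since subtraction is awkward in
  \<open>ennreal\<close>.\<close>

lemma has_real_derivative_nn_integral_atMost:
  fixes V h :: "real \<Rightarrow> real"
  assumes [measurable]: "h \<in> borel_measurable borel"
    and h: "\<And>u. h u \<ge> 0" and V: "\<And>c. V c \<ge> 0"
    and eq: "\<And>c. ennreal (V c) = (\<integral>\<^sup>+u. indicator {..c} u * ennreal (h u) \<partial>lborel)"
    and cont: "isCont h c"
  shows "(V has_real_derivative h c) (at c)"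
proof -
  have bound: "\<bar>V b - V a - h c * (b - a)\<bar> \<le> e * (b - a)"
    if ab: "a \<le> b" and e: "\<And>u. u \<in> {a..b} \<Longrightarrow> \<bar>h u - h c\<bar> \<le> e" for a b e
  proof -
    have e0: "e \<ge> 0" using e[of a] ab by auto
    have "ennreal (V b) = (\<integral>\<^sup>+u. indicator {..a} u * ennreal (h u) + indicator {a<..b} u * ennreal (h u) \<partial>lborel)"
      unfolding eq using ab by (intro nn_integral_cong) (auto simp: indicator_def)
    also have "\<dots> = ennreal (V a) + (\<integral>\<^sup>+u. indicator {a<..b} u * ennreal (h u) \<partial>lborel)"
      unfolding eq by (rule nn_integral_add) measurable
    finally have split: "ennreal (V b) = ennreal (V a) + (\<integral>\<^sup>+u. indicator {a<..b} u * ennreal (h u) \<partial>lborel)" .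
    have const: "(\<integral>\<^sup>+u. ennreal r * indicator {a<..b} u \<partial>lborel) = ennreal (r * (b - a))" if "r \<ge> 0" for r
      using ab that by (simp add: nn_integral_cmult_indicator ennreal_mult)
    have "(\<integral>\<^sup>+u. indicator {a<..b} u * ennreal (h u) \<partial>lborel) \<le> (\<integral>\<^sup>+u. ennreal (h c + e) * indicator {a<..b} u \<partial>lborel)"
    proof (intro nn_integral_mono)
      fix u :: real
      show "indicator {a<..b} u * ennreal (h u) \<le> ennreal (h c + e) * indicator {a<..b} u"
        using e[of u] by (auto simp: indicator_def intro!: ennreal_leI)
    qed
    also have "\<dots> = ennreal ((h c + e) * (b - a))" using h e0 by (intro const) simp
    finally have "ennreal (V b) \<le> ennreal (V a) + ennreal ((h c + e) * (b - a))"
      unfolding split by (rule add_left_mono)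
    also have "\<dots> = ennreal (V a + (h c + e) * (b - a))"
      using V h[of c] e0 ab by (subst ennreal_plus) auto
    finally have up: "V b \<le> V a + (h c + e) * (b - a)"
      using V[of a] h[of c] e0 ab by (subst (asm) ennreal_le_iff) auto
    \<comment> \<open>\<open>h c - e\<close> may be negative; truncating at 0 keeps the minorant of
      \<open>h\<close> nonnegative, and the estimate with \<open>h c - e\<close> is weaker.\<close>
    let ?r = "max 0 (h c - e)"
    have "ennreal (?r * (b - a)) = (\<integral>\<^sup>+u. ennreal ?r * indicator {a<..b} u \<partial>lborel)"
      by (intro const[symmetric]) simp
    also have "\<dots> \<le> (\<integral>\<^sup>+u. indicator {a<..b} u * ennreal (h u) \<partial>lborel)"
    proof (intro nn_integral_mono)
      fix u :: real
      show "ennreal ?r * indicator {a<..b} u \<le> indicator {a<..b} u * ennreal (h u)"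
        using e[of u] h[of u] by (auto simp: indicator_def intro!: ennreal_leI)
    qed
    finally have "ennreal (V a) + ennreal (?r * (b - a)) \<le> ennreal (V b)"
      unfolding split by (rule add_left_mono)
    then have "ennreal (V a + ?r * (b - a)) \<le> ennreal (V b)"
      using V ab by (subst ennreal_plus) auto
    then have "V a + ?r * (b - a) \<le> V b" using V[of b] by (subst (asm) ennreal_le_iff) auto
    moreover have "(h c - e) * (b - a) \<le> ?r * (b - a)" using ab by (intro mult_right_mono) auto
    ultimately show ?thesis using up by (simp add: abs_le_iff algebra_simps)
  qed
  show ?thesis unfolding has_field_derivative_def has_derivative_at_alt
  proof (intro conjI allI impI)
    show "bounded_linear ((*) (h c))" by (rule bounded_linear_mult_right)
    fix e :: real assume "e > 0"
    then obtain d where d: "d > 0" "\<And>u. \<bar>u - c\<bar> < d \<Longrightarrow> \<bar>h u - h c\<bar> < e"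
      using cont unfolding continuous_at_eps_delta dist_real_def by blast
    show "\<exists>d>0. \<forall>y. norm (y - c) < d \<longrightarrow> norm (V y - V c - h c * (y - c)) \<le> e * norm (y - c)"
    proof (intro exI[of _ d] conjI d allI impI)
      fix y assume y: "norm (y - c) < d"
      show "norm (V y - V c - h c * (y - c)) \<le> e * norm (y - c)"
      proof (cases "y \<ge> c")
        case True
        then show ?thesis using bound[of c y e] d(2) y by (force intro: less_imp_le)
      next
        case False
        have "\<bar>V c - V y - h c * (c - y)\<bar> \<le> e * (c - y)"
          by (rule bound) (use False y in \<open>auto intro!: less_imp_le d(2)\<close>)
        then show ?thesis using False by (simp add: abs_le_iff algebra_simps)
      qed
    qed
  qed
qed

lemma ineq_vol_section_measurable:
  assumes fin: "finite I"
  shows "(\<lambda>u. ineq_vol m I A (\<lambda>k. x k - B k * u)) \<in> borel_measurable borel"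
proof -
  interpret sigma_finite_measure "coord_lborel m"
    by (rule lborel_coords.sigma_finite) simp
  let ?Q = "{p \<in> space (borel \<Otimes>\<^sub>M coord_lborel m). \<forall>k\<in>I. (\<Sum>l<m. A k l * snd p l) \<le> x k - B k * fst p}"
  have "(\<lambda>p. snd p l) \<in> borel_measurable (borel \<Otimes>\<^sub>M coord_lborel m)" if "l < m" for l
    using that measurable_compose[OF measurable_snd measurable_component_singleton[of l "{..<m}" "\<lambda>_. lborel"]]
    by (simp add: measurable_lborel1)
  then have [measurable]: "(\<lambda>p. \<Sum>l<m. A k l * snd p l) \<in> borel_measurable (borel \<Otimes>\<^sub>M coord_lborel m)" for k
    by (intro borel_measurable_sum borel_measurable_times) auto
  have "?Q \<in> sets (borel \<Otimes>\<^sub>M coord_lborel m)" using fin by measurable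
  from measurable_emeasure_Pair[OF this]
  have "(\<lambda>u. enn2real (emeasure (coord_lborel m) (Pair u -` ?Q))) \<in> borel_measurable borel"
    by measurable
  also have "(\<lambda>u. enn2real (emeasure (coord_lborel m) (Pair u -` ?Q))) = (\<lambda>u. ineq_vol m I A (\<lambda>k. x k - B k * u))"
    unfolding ineq_vol_def measure_def ineq_set_def
    by (intro ext arg_cong[where f=enn2real] arg_cong2[where f=emeasure]) (auto simp: space_pair_measure)
  finally show ?thesis .
qed

text \<open>The bound of row \<open>i\<close> enters \<open>ineq_vol_Suc\<close> only through the
  upper limit, so its derivative is the integrand there, that is, the volume of the slice on which
  row \<open>i\<close> is an equality. The factor \<open>1 / A i m\<close> converts the bound into
  the coordinate.\<close>

lemma ineq_vol_has_derivative:
  assumes fin: "finite I" and bd: "bounding (Suc m) I A C"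
    and i: "i \<in> I" "\<And>l. l < m \<Longrightarrow> A i l = 0" "A i m > 0"
    and nondeg: "\<And>k. k \<in> I \<Longrightarrow> k \<noteq> i \<Longrightarrow> (\<exists>l<m. A k l \<noteq> 0) \<or> x k - A k m / A i m * x i \<noteq> 0"
  shows "((\<lambda>s. ineq_vol (Suc m) I A (x(i := s))) has_real_derivative
     ineq_vol m (I - {i}) A (\<lambda>k. x k - A k m / A i m * x i) / A i m) (at (x i))"
proof -
  let ?c = "x i / A i m"
  define h where "h u = ineq_vol m (I - {i}) A (\<lambda>k. x k - A k m * u)" for u
  define V where "V c = ineq_vol (Suc m) I A (x(i := c * A i m))" for c
  note bd' = bounding_step[OF bd i(2)]
  have "(V has_real_derivative h ?c) (at ?c)"
  proof (rule has_real_derivative_nn_integral_atMost)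
    show "h \<in> borel_measurable borel" unfolding h_def
      using fin by (intro ineq_vol_section_measurable) auto
    show "h u \<ge> 0" "V u \<ge> 0" for u by (auto simp: h_def V_def ineq_vol_def)
    show "ennreal (V c) = (\<integral>\<^sup>+u. indicator {..c} u * ennreal (h u) \<partial>lborel)" for c
    proof -
      have "ineq_vol m (I - {i}) A (\<lambda>k. (x(i := c * A i m)) k - A k m * u) = h u" for u
        unfolding h_def ineq_vol_def by (intro arg_cong[where f="measure _"] ineq_set_cong) auto
      then show ?thesis
        unfolding V_def using ineq_vol_Suc[OF fin bd i, of "x(i := c * A i m)"] i(3) by simp
    qed
    show "isCont h ?c" unfolding h_def
      using fin nondeg by (intro isCont_ineq_vol[OF _ bd']) (auto intro!: continuous_intros)
  qed
  then have "((\<lambda>s. V (s / A i m)) has_real_derivative h ?c * (1 / A i m)) (at (x i))"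
    by (rule DERIV_chain'[rotated]) (use i(3) in \<open>auto intro!: derivative_eq_intros\<close>)
  moreover have "V (s / A i m) = ineq_vol (Suc m) I A (x(i := s))" for s
    using i(3) by (simp add: V_def)
  ultimately show ?thesis by (simp add: h_def)
qed

section \<open>Orthonormal frames and rotation invariance\<close>

text \<open>By Vitali's covering theorem an open set is, up to a null set, a countable disjoint
  union of balls. An orthogonal map sends balls to balls of the same radius, and being
  differentiable it keeps the remainder null.\<close>

lemma emeasure_orthogonal_image_open:
  fixes T :: "'a::euclidean_space \<Rightarrow> 'a"
  assumes T: "orthogonal_transformation T" and U: "open U"
  shows "emeasure lborel (T ` U) = emeasure lborel U"
proof -
  have lin: "linear T" and bij: "bij T"
    using T by (auto simp: orthogonal_transformation_linear orthogonal_transformation_bij)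
  have open_T: "open (T ` X)" if "open X" for X
    using open_surjective_linear_image[OF that lin] bij by (auto simp: bij_def)
  define K where "K = {p::'a \<times> real. snd p > 0 \<and> ball (fst p) (snd p) \<subseteq> U}"
  have K: "\<exists>i. i \<in> K \<and> x \<in> ball (fst i) (snd i) \<and> snd i < d" if xU: "x \<in> U" and "d > 0" for x d
  proof -
    obtain e where "e > 0" "ball x e \<subseteq> U" by (rule openE[OF U xU])
    then show ?thesis using that(2)
      by (intro exI[of _ "(x, min e (d/2))"]) (auto simp: K_def)
  qed
  obtain C where C: "countable C" "C \<subseteq> K"
     "pairwise (\<lambda>i j. disjnt (ball (fst i) (snd i)) (ball (fst j) (snd j))) C"
     "negligible (U - (\<Union>i \<in> C. ball (fst i) (snd i)))"
    using K by (rule Vitali_covering_theorem_balls)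
  let ?B = "\<lambda>i::'a \<times> real. ball (fst i) (snd i)"
  let ?N = "U - (\<Union>i\<in>C. ?B i)"
  have Ueq: "U = (\<Union>i\<in>C. ?B i) \<union> ?N" using C(2) by (auto simp: K_def)
  have open_Un: "open (\<Union>i\<in>C. ?B i)" by auto
  have N: "?N \<in> null_sets lborel"
    using C(4) U open_Un by (subst null_sets_completion_iff[symmetric]) (auto simp: negligible_iff_null_sets)
  have "negligible (T ` ?N)"
    by (rule negligible_differentiable_image_negligible[OF order_refl C(4)])
       (simp add: linear_imp_differentiable_on lin)
  moreover have "T ` ?N = T ` U - T ` (\<Union>i\<in>C. ?B i)"
    using bij by (simp add: bij_def image_set_diff)
  ultimately have TN: "T ` ?N \<in> null_sets lborel"
    using open_T[OF U] open_T[OF open_Un]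
    by (subst null_sets_completion_iff[symmetric]) (auto simp: negligible_iff_null_sets)
  have TB: "T ` ?B i = ball (T (fst i)) (snd i)" for i
    by (rule image_orthogonal_transformation_ball[OF T])
  have disj: "disjoint_family_on ?B C"
    using C(3) by (auto simp: disjoint_family_on_def pairwise_def disjnt_def)
  have Tdisj: "disjoint_family_on (\<lambda>i. T ` ?B i) C"
    using disj bij unfolding disjoint_family_on_def bij_def by (metis image_Int image_empty)
  have "emeasure lborel (T ` U) = emeasure lborel ((\<Union>i\<in>C. T ` ?B i) \<union> T ` ?N)"
    by (subst Ueq) (simp only: image_Un image_UN)
  also have "\<dots> = emeasure lborel (\<Union>i\<in>C. T ` ?B i)"
    by (rule emeasure_Un_null_set[OF _ TN]) (auto simp: TB intro!: borel_open)
  also have "\<dots> = (\<integral>\<^sup>+i. emeasure lborel (T ` ?B i) \<partial>count_space C)"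
    by (rule emeasure_UN_countable[OF _ C(1) Tdisj]) (auto simp: TB)
  also have "\<dots> = (\<integral>\<^sup>+i. emeasure lborel (?B i) \<partial>count_space C)"
    using C(2) by (intro nn_integral_cong) (auto simp: TB emeasure_ball K_def)
  also have "\<dots> = emeasure lborel (\<Union>i\<in>C. ?B i)"
    by (rule emeasure_UN_countable[OF _ C(1) disj, symmetric]) auto
  also have "\<dots> = emeasure lborel ((\<Union>i\<in>C. ?B i) \<union> ?N)"
    by (rule emeasure_Un_null_set[OF _ N, symmetric]) (auto intro!: borel_open)
  finally show ?thesis using Ueq by simp
qed

lemma lborel_distr_orthogonal:
  fixes T :: "'a::euclidean_space \<Rightarrow> 'a"
  assumes T: "orthogonal_transformation T"
  shows "distr lborel borel T = lborel"
proof (rule lborel_eqI[symmetric])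
  have [measurable]: "T \<in> borel_measurable borel"
    using T by (intro borel_measurable_continuous_onI linear_continuous_on)
       (simp add: linear_conv_bounded_linear[symmetric] orthogonal_transformation_linear)
  have inv: "orthogonal_transformation (inv T)" by (rule orthogonal_transformation_inv[OF T])
  fix l u :: 'a assume le: "\<And>b. b \<in> Basis \<Longrightarrow> l \<bullet> b \<le> u \<bullet> b"
  have "T -` box l u = inv T ` box l u"
    using orthogonal_transformation_bij[OF T] by (rule bij_vimage_eq_inv_image)
  then show "emeasure (distr lborel borel T) (box l u) = ennreal (\<Prod>b\<in>Basis. (u - l) \<bullet> b)"
    using le emeasure_orthogonal_image_open[OF inv open_box, of l u]
    by (simp add: emeasure_distr)
qed auto

section \<open>Orthonormal frames and the measure they induce\<close>

lemma orthonormal_frameD: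
  assumes "orthonormal_frame k b"
  shows "inj_on b {..<k}" "pairwise orthogonal (b ` {..<k})" "i < k \<Longrightarrow> norm (b i) = 1"
    "independent (b ` {..<k})"
proof -
  show "inj_on b {..<k}" using assms unfolding orthonormal_frame_def inj_on_def
    by (metis lessThan_iff zero_neq_one)
  show o: "pairwise orthogonal (b ` {..<k})"
    using assms by (auto simp: orthonormal_frame_def pairwise_def orthogonal_def)
  show "norm (b i) = 1" if "i < k" for i
    using assms that by (simp add: orthonormal_frame_def norm_eq_1)
  then have "0 \<notin> b ` {..<k}" by force
  then show "independent (b ` {..<k})" using pairwise_orthogonal_independent[OF o] by blast
qed

lemma orthonormal_frame_mono: "orthonormal_frame k b \<Longrightarrow> j \<le> k \<Longrightarrow> orthonormal_frame j b"
  by (simp add: orthonormal_frame_def)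

lemma orthonormal_frame_expand:
  fixes b :: "nat \<Rightarrow> 'a::euclidean_space"
  assumes b: "orthonormal_frame DIM('a) b"
  shows "(\<Sum>l<DIM('a). (p \<bullet> b l) *\<^sub>R b l) = p"
proof -
  note b' = orthonormal_frameD[OF b]
  have "card (b ` {..<DIM('a)}) = DIM('a)" using card_image[OF b'(1)] by simp
  then have "span (b ` {..<DIM('a)}) = UNIV"
    using b'(4) by (metis dim_eq_card_independent dim_eq_full)
  then have "(\<Sum>i\<in>b ` {..<DIM('a)}. (p \<bullet> i) *\<^sub>R i) = p"
    using b'(2,3) by (intro orthonormal_basis_expand) auto
  then show ?thesis by (simp add: sum.reindex[OF b'(1)])
qed

lemma orthonormal_frame_extend:
  fixes b :: "nat \<Rightarrow> 'a::euclidean_space"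
  assumes "orthonormal_frame m b" "m \<le> n" "n \<le> DIM('a)"
  shows "\<exists>b'. orthonormal_frame n b' \<and> (\<forall>l<m. b' l = b l)"
  using assms(2,3)
proof (induction n rule: dec_induct)
  case base
  then show ?case using assms(1) by blast
next
  case (step n)
  then obtain b' where b': "orthonormal_frame n b'" "\<forall>l<m. b' l = b l" by auto
  have "dim (b' ` {..<n}) \<le> n"
    using dim_le_card'[of "b' ` {..<n}"] card_image_le[of "{..<n}" b'] by simp
  then obtain u where u: "u \<noteq> 0" "\<And>y. y \<in> span (b' ` {..<n}) \<Longrightarrow> orthogonal u y"
    using orthogonal_to_subspace_exists[of "b' ` {..<n}"] step by (metis Suc_le_eq le_less_trans)
  define w where "w = u /\<^sub>R norm u"
  have w: "w \<bullet> b' l = 0" "b' l \<bullet> w = 0" if "l < n" for l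
    using u(2)[OF span_base, of "b' l"] that by (auto simp: w_def orthogonal_def inner_commute)
  have ww: "w \<bullet> w = 1" using u(1) by (simp add: w_def dot_square_norm power2_eq_square)
  have "orthonormal_frame (Suc n) (b'(n := w))"
    using b'(1) w ww by (auto simp: orthonormal_frame_def less_Suc_eq)
  moreover have "\<forall>l<m. (b'(n := w)) l = b l" using b'(2) step(1) by auto
  ultimately show ?case by blast
qed

text \<open>Extension keeps prescribed vectors in front, whereas slicing needs the normal
  last.\<close>

lemma orthonormal_frame_rev:
  assumes "orthonormal_frame k b"
  shows "orthonormal_frame k (\<lambda>l. b (k - 1 - l))"
  using assms by (auto simp: orthonormal_frame_def)

text \<open>For a frame \<open>e\<close> enumerating \<open>Basis\<close> this is the product
  formula for boxes; any other frame differs from it by the orthogonal map taking each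
  \<open>e l\<close> to \<open>b l\<close>.\<close>

lemma lborel_distr_frame:
  fixes b :: "nat \<Rightarrow> 'a::euclidean_space"
  assumes b: "orthonormal_frame DIM('a) b"
  shows "distr (coord_lborel DIM('a)) borel (\<lambda>y. \<Sum>l<DIM('a). y l *\<^sub>R b l) = lborel"
proof -
  let ?d = "DIM('a)"
  obtain e where e: "bij_betw e {..<?d} (Basis :: 'a set)"
    using ex_bij_betw_nat_finite[OF finite_Basis] by (auto simp: atLeast0LessThan)
  have e_inner: "e i \<bullet> e j = (if i = j then 1 else 0)" if "i < ?d" "j < ?d" for i j
  proof -
    have "e i \<in> Basis" "e j \<in> Basis" "e i = e j \<longleftrightarrow> i = j"
      using that e by (auto simp: bij_betw_def inj_on_eq_iff)
    then show ?thesis by (simp add: inner_Basis)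
  qed
  have frame_e: "orthonormal_frame ?d e" by (simp add: orthonormal_frame_def e_inner)
  let ?E = "\<lambda>y. \<Sum>l<?d. y l *\<^sub>R e l"
  have meas [measurable]: "(\<lambda>y. \<Sum>l<?d. y l *\<^sub>R c l) \<in> coord_lborel ?d \<rightarrow>\<^sub>M borel" for c :: "nat \<Rightarrow> 'a"
    by measurable
  have E: "distr (coord_lborel ?d) borel ?E = lborel"
  proof (rule lborel_eqI[symmetric])
    fix l u :: 'a assume le: "\<And>b. b \<in> Basis \<Longrightarrow> l \<bullet> b \<le> u \<bullet> b"
    have coord: "?E y \<bullet> e j = y j" if "j < ?d" for y j
      using that by (simp add: inner_sum_left e_inner if_distrib[of "(*) _"] cong: if_cong)
    have ball_Basis: "(\<forall>b\<in>Basis. P b) \<longleftrightarrow> (\<forall>j<?d. P (e j))" for P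
      using bij_betw_imp_surj_on[OF e] by (metis imageE imageI lessThan_iff)
    have le': "l \<bullet> e j \<le> u \<bullet> e j" if "j < ?d" for j
      using le ball_Basis[of "\<lambda>b. l \<bullet> b \<le> u \<bullet> b"] that by blast
    have "?E y \<in> box l u \<longleftrightarrow> (\<forall>j<?d. l \<bullet> e j < y j \<and> y j < u \<bullet> e j)" for y
      by (simp add: box_def ball_Basis coord)
    then have "?E -` box l u \<inter> space (coord_lborel ?d) = Pi\<^sub>E {..<?d} (\<lambda>j. {l \<bullet> e j<..<u \<bullet> e j})"
      by (intro set_eqI) (simp add: space_PiM PiE_iff Ball_def conj_commute)
    then have "emeasure (distr (coord_lborel ?d) borel ?E) (box l u)
        = emeasure (coord_lborel ?d) (Pi\<^sub>E {..<?d} (\<lambda>j. {l \<bullet> e j<..<u \<bullet> e j}))"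
      by (simp add: emeasure_distr)
    also have "\<dots> = (\<Prod>j<?d. emeasure lborel {l \<bullet> e j<..<u \<bullet> e j})"
      by (intro lborel_coords.emeasure_PiM) auto
    also have "\<dots> = (\<Prod>j<?d. ennreal ((u - l) \<bullet> e j))"
      using le' by (intro prod.cong) (auto simp: inner_diff_left)
    also have "\<dots> = ennreal (\<Prod>j<?d. (u - l) \<bullet> e j)"
      using le' by (intro prod_ennreal) (auto simp: inner_diff_left)
    also have "(\<Prod>j<?d. (u - l) \<bullet> e j) = (\<Prod>b\<in>Basis. (u - l) \<bullet> b)"
      using e by (intro prod.reindex_bij_betw)
    finally show "emeasure (distr (coord_lborel ?d) borel ?E) (box l u) = ennreal (\<Prod>b\<in>Basis. (u - l) \<bullet> b)" .
  qed auto
  define T where "T p = (\<Sum>l<?d. (p \<bullet> e l) *\<^sub>R b l)" for p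
  have T: "orthogonal_transformation T"
    unfolding orthogonal_transformation_def
  proof (intro conjI allI)
    show "linear T" unfolding T_def
      by (intro linearI) (auto simp: inner_add_left scaleR_add_left sum.distrib scaleR_sum_right)
    fix p q
    have "T p \<bullet> T q = (\<Sum>l<?d. (p \<bullet> e l) * (q \<bullet> e l))"
      using b by (simp add: T_def inner_sum_left inner_sum_right orthonormal_frame_def
          mult.commute if_distrib[of "(*) _"] cong: if_cong)
    also have "\<dots> = p \<bullet> (\<Sum>l<?d. (q \<bullet> e l) *\<^sub>R e l)" by (simp add: inner_sum_right mult.commute)
    also have "\<dots> = p \<bullet> q" using orthonormal_frame_expand[OF frame_e] by simp
    finally show "T p \<bullet> T q = p \<bullet> q" .
  qed
  have [measurable]: "T \<in> borel_measurable borel" unfolding T_def by measurable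
  have "lborel = distr (distr (coord_lborel ?d) borel ?E) borel T"
    by (simp add: E lborel_distr_orthogonal[OF T])
  also have "\<dots> = distr (coord_lborel ?d) borel (\<lambda>y. T (?E y))"
    by (subst distr_distr) (auto simp: comp_def)
  also have "(\<lambda>y. T (?E y)) = (\<lambda>y. \<Sum>l<?d. y l *\<^sub>R b l)"
    by (simp add: T_def inner_sum_left e_inner if_distrib[of "(*) _"] cong: if_cong)
  finally show ?thesis ..
qed

section \<open>Differentiation and symmetric matrices\<close>

lemma has_real_derivative_shift_line:
  fixes f :: "'a::real_vector \<Rightarrow> real"
  assumes "((\<lambda>t. f ((y + s *\<^sub>R u) + t *\<^sub>R u)) has_real_derivative D) (at 0)"
  shows "((\<lambda>t. f (y + t *\<^sub>R u)) has_real_derivative D) (at s)"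
  using DERIV_shift[of "\<lambda>t. f (y + t *\<^sub>R u)" D 0 s] assms
  by (simp add: algebra_simps scaleR_add_left)

text \<open>Peano's form of Schwarz's theorem: continuity of one mixed derivative suffices, and the
  other one then exists.\<close>

lemma mixed_derivative_swap:
  fixes f g k D :: "'a::real_normed_vector \<Rightarrow> real"
  assumes g: "\<forall>\<^sub>F y in nhds x. ((\<lambda>t. f (y + t *\<^sub>R w)) has_real_derivative g y) (at 0)"
    and k: "\<forall>\<^sub>F y in nhds x. ((\<lambda>t. f (y + t *\<^sub>R u)) has_real_derivative k y) (at 0)"
    and D: "\<forall>\<^sub>F y in nhds x. ((\<lambda>t. g (y + t *\<^sub>R u)) has_real_derivative D y) (at 0)"
    and cont: "isCont D x"
  shows "((\<lambda>t. k (x + t *\<^sub>R w)) has_real_derivative D x) (at 0)"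
  unfolding has_field_derivative_def has_derivative_at_alt
proof (intro conjI allI impI)
  show "bounded_linear ((*) (D x))" by (rule bounded_linear_mult_right)
  fix e :: real assume e: "e > 0"
  have "\<forall>\<^sub>F y in nhds x. dist (D y) (D x) < e"
    using cont e by (simp add: isCont_def tendsto_at_iff_tendsto_nhds tendstoD)
  with g k D have "\<forall>\<^sub>F y in nhds x. ((\<lambda>t. f (y + t *\<^sub>R w)) has_real_derivative g y) (at 0) \<and>
      ((\<lambda>t. f (y + t *\<^sub>R u)) has_real_derivative k y) (at 0) \<and>
      ((\<lambda>t. g (y + t *\<^sub>R u)) has_real_derivative D y) (at 0) \<and> dist (D y) (D x) < e"
    by eventually_elim auto
  then obtain r where r: "r > 0" and R: "\<And>y. dist y x < r \<Longrightarrow>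
      ((\<lambda>t. f (y + t *\<^sub>R w)) has_real_derivative g y) (at 0) \<and>
      ((\<lambda>t. f (y + t *\<^sub>R u)) has_real_derivative k y) (at 0) \<and>
      ((\<lambda>t. g (y + t *\<^sub>R u)) has_real_derivative D y) (at 0) \<and> dist (D y) (D x) < e"
    unfolding eventually_nhds_metric by blast
  \<comment> \<open>With \<open>s\<close> and \<open>t\<close> below \<open>q\<close> in absolute
    value, the parallelogram spanned at \<open>x\<close> stays inside the ball of radius
    \<open>r\<close>; the \<open>+ 1\<close> covers vanishing directions.\<close>
  define q where "q = r / (norm u + norm w + 1)"
  have q: "q > 0" unfolding q_def using r by (simp add: add_nonneg_pos)
  have near: "dist (x + s *\<^sub>R u + t *\<^sub>R w) x < r" if "\<bar>s\<bar> < q" "\<bar>t\<bar> < q" for s t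
  proof -
    have "norm (s *\<^sub>R u + t *\<^sub>R w) \<le> \<bar>s\<bar> * norm u + \<bar>t\<bar> * norm w"
      by (metis norm_scaleR norm_triangle_ineq)
    also have "\<dots> \<le> q * norm u + q * norm w"
      using that by (intro add_mono mult_right_mono) auto
    also have "\<dots> < q * (norm u + norm w + 1)" using q by (simp add: algebra_simps)
    also have "\<dots> = r" unfolding q_def by (simp add: add_nonneg_eq_0_iff)
    finally show ?thesis by (simp add: dist_norm add.assoc)
  qed
  have g_bound: "\<bar>g (x + s *\<^sub>R u + t *\<^sub>R w) - g (x + t *\<^sub>R w) - s * D x\<bar> \<le> e * \<bar>s\<bar>"
    if st: "\<bar>s\<bar> < q" "\<bar>t\<bar> < q" for s t
  proof -
    have "norm ((g (x + s *\<^sub>R u + t *\<^sub>R w) - s * D x) - (g (x + 0 *\<^sub>R u + t *\<^sub>R w) - 0 * D x)) \<le> e * norm (s - 0)"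
    proof (rule field_differentiable_bound[where S="{-q<..<q}" and
          f="\<lambda>s. g (x + s *\<^sub>R u + t *\<^sub>R w) - s * D x" and f'="\<lambda>s. D (x + s *\<^sub>R u + t *\<^sub>R w) - D x"])
      fix z assume z: "z \<in> {-q<..<q}"
      then have "\<bar>z\<bar> < q" by auto
      note n = R[OF near[OF this st(2)]]
      have "((\<lambda>s. g ((x + t *\<^sub>R w) + s *\<^sub>R u)) has_real_derivative D (x + z *\<^sub>R u + t *\<^sub>R w)) (at z)"
        by (rule has_real_derivative_shift_line) (use n in \<open>simp add: add_ac\<close>)
      then have A: "((\<lambda>s. g (x + s *\<^sub>R u + t *\<^sub>R w)) has_real_derivative D (x + z *\<^sub>R u + t *\<^sub>R w)) (at z)"
        by (simp add: add_ac)
      have B: "((\<lambda>s. s * D x) has_real_derivative D x) (at z)"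
        by (auto intro!: derivative_eq_intros)
      show "((\<lambda>s. g (x + s *\<^sub>R u + t *\<^sub>R w) - s * D x) has_real_derivative D (x + z *\<^sub>R u + t *\<^sub>R w) - D x) (at z within {-q<..<q})"
        by (rule has_field_derivative_at_within[OF DERIV_diff[OF A B]])
      show "norm (D (x + z *\<^sub>R u + t *\<^sub>R w) - D x) \<le> e"
        using n by (simp add: dist_norm)
    qed (use st q in \<open>auto simp: abs_less_iff\<close>)
    then show ?thesis by simp
  qed
  \<comment> \<open>Mean value theorem in \<open>t\<close>, with \<open>g_bound\<close> controlling
    the derivative: the second difference of \<open>f\<close> is \<open>s * t * D x\<close> up to
    \<open>e * \<bar>s\<bar> * \<bar>t\<bar>\<close>.\<close>
  have f_bound: "\<bar>f (x + s *\<^sub>R u + t *\<^sub>R w) - f (x + t *\<^sub>R w) - (f (x + s *\<^sub>R u) - f x) - t * (s * D x)\<bar> \<le> (e * \<bar>s\<bar>) * \<bar>t\<bar>"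
    if st: "\<bar>s\<bar> < q" "\<bar>t\<bar> < q" for s t
  proof -
    let ?F = "\<lambda>t. f (x + s *\<^sub>R u + t *\<^sub>R w) - f (x + t *\<^sub>R w) - t * (s * D x)"
    have "norm (?F t - ?F 0) \<le> (e * \<bar>s\<bar>) * norm (t - 0)"
    proof (rule field_differentiable_bound[where S="{-q<..<q}" and f="?F" and
          f'="\<lambda>t. g (x + s *\<^sub>R u + t *\<^sub>R w) - g (x + t *\<^sub>R w) - s * D x"])
      fix z assume z: "z \<in> {-q<..<q}"
      then have z': "\<bar>z\<bar> < q" by auto
      note n = R[OF near[OF st(1) z']] and n0 = R[OF near[OF _ z', of 0]]
      have A: "((\<lambda>t. f ((x + s *\<^sub>R u) + t *\<^sub>R w)) has_real_derivative g (x + s *\<^sub>R u + z *\<^sub>R w)) (at z)"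
        by (rule has_real_derivative_shift_line) (use n in simp)
      have B: "((\<lambda>t. f (x + t *\<^sub>R w)) has_real_derivative g (x + z *\<^sub>R w)) (at z)"
        by (rule has_real_derivative_shift_line) (use n0 q in simp)
      have C: "((\<lambda>t. t * (s * D x)) has_real_derivative s * D x) (at z)"
        by (auto intro!: derivative_eq_intros)
      show "(?F has_real_derivative g (x + s *\<^sub>R u + z *\<^sub>R w) - g (x + z *\<^sub>R w) - s * D x) (at z within {-q<..<q})"
        by (rule has_field_derivative_at_within[OF DERIV_diff[OF DERIV_diff[OF A B] C]])
      show "norm (g (x + s *\<^sub>R u + z *\<^sub>R w) - g (x + z *\<^sub>R w) - s * D x) \<le> e * \<bar>s\<bar>"
        using g_bound[OF st(1) z'] by simp
    qed (use st q in \<open>auto simp: abs_less_iff\<close>)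
    then show ?thesis by (simp add: algebra_simps)
  qed
  show "\<exists>d>0. \<forall>t. norm (t - 0) < d \<longrightarrow>
      norm (k (x + t *\<^sub>R w) - k (x + 0 *\<^sub>R w) - D x * (t - 0)) \<le> e * norm (t - 0)"
  proof (intro exI[of _ q] conjI q allI impI)
    fix t :: real assume "norm (t - 0) < q"
    then have t: "\<bar>t\<bar> < q" by simp
    \<comment> \<open>The same second difference is now read as a difference in \<open>s\<close>:
      divided by \<open>s\<close>, it tends to the increment of \<open>k\<close>, and the non-strict
      bound survives the limit.\<close>
    let ?\<phi> = "\<lambda>s. f ((x + t *\<^sub>R w) + s *\<^sub>R u) - f (x + s *\<^sub>R u)"
    have "(?\<phi> has_real_derivative k (x + t *\<^sub>R w) - k x) (at 0)"
      using R[OF near[of 0 t]] R[OF near[of 0 0]] q t by (intro derivative_intros) auto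
    then have "(\<lambda>s. (?\<phi> s - ?\<phi> 0) / s) \<midarrow>0\<rightarrow> k (x + t *\<^sub>R w) - k x"
      unfolding DERIV_def by simp
    then have "(\<lambda>s. \<bar>(?\<phi> s - ?\<phi> 0) / s - t * D x\<bar>) \<midarrow>0\<rightarrow> \<bar>(k (x + t *\<^sub>R w) - k x) - t * D x\<bar>"
      by (intro tendsto_intros)
    moreover have "\<forall>\<^sub>F s in at 0. \<bar>(?\<phi> s - ?\<phi> 0) / s - t * D x\<bar> \<le> e * \<bar>t\<bar>"
      unfolding eventually_at
    proof (intro exI[of _ q] conjI q ballI impI)
      fix s :: real assume s: "s \<noteq> 0 \<and> dist s 0 < q"
      have "(?\<phi> s - ?\<phi> 0) / s - t * D x = (?\<phi> s - ?\<phi> 0 - t * (s * D x)) / s"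
        using s by (simp add: diff_divide_distrib)
      then have "\<bar>(?\<phi> s - ?\<phi> 0) / s - t * D x\<bar> = \<bar>?\<phi> s - ?\<phi> 0 - t * (s * D x)\<bar> / \<bar>s\<bar>"
        by (metis abs_divide)
      also have "\<dots> \<le> (e * \<bar>s\<bar> * \<bar>t\<bar>) / \<bar>s\<bar>"
        using f_bound[of s t] s t by (intro divide_right_mono) (auto simp: add_ac)
      also have "\<dots> = e * \<bar>t\<bar>" using s by simp
      finally show "\<bar>(?\<phi> s - ?\<phi> 0) / s - t * D x\<bar> \<le> e * \<bar>t\<bar>" .
    qed
    ultimately have "\<bar>(k (x + t *\<^sub>R w) - k x) - t * D x\<bar> \<le> e * \<bar>t\<bar>"
      by (rule tendsto_upperbound) simp
    then show "norm (k (x + t *\<^sub>R w) - k (x + 0 *\<^sub>R w) - D x * (t - 0)) \<le> e * norm (t - 0)"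
      by (simp add: mult.commute)
  qed
qed

lemma eventually_line_nhds:
  assumes "\<forall>\<^sub>F y in nhds x. P y"
  shows "\<forall>\<^sub>F t in nhds (0::real). P (x + t *\<^sub>R (u :: 'a::real_normed_vector))"
proof -
  have "((\<lambda>t. x + t *\<^sub>R u) \<longlongrightarrow> x + 0 *\<^sub>R u) (nhds (0::real))"
    by (intro tendsto_intros filterlim_ident)
  then have "filterlim (\<lambda>t. x + t *\<^sub>R u) (nhds x) (nhds (0::real))" by simp
  then show ?thesis by (rule eventually_compose_filterlim[OF assms])
qed

text \<open>\<open>x\<close> is joined to a nearby point by changing one coordinate at a time; on
  each leg the mean value theorem costs \<open>e\<close> times the length of the leg. Continuity of
  the partial derivatives at \<open>x\<close> alone suffices for this.\<close>

lemma has_derivative_continuous_partials: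
  fixes f :: "real^'n::finite \<Rightarrow> real"
  assumes g: "\<And>j. \<forall>\<^sub>F y in nhds x. ((\<lambda>t. f (y + t *\<^sub>R axis j 1)) has_real_derivative g j y) (at 0)"
    and cont: "\<And>j. isCont (g j) x"
  shows "(f has_derivative (\<lambda>h. \<Sum>j\<in>UNIV. g j x * h $ j)) (at x)"
  unfolding has_derivative_at_alt
proof (intro conjI allI impI)
  show "bounded_linear (\<lambda>h. \<Sum>j\<in>UNIV. g j x * h $ j)"
    by (intro bounded_linear_sum bounded_linear_const_mult bounded_linear_vec_nth)
  fix e0 :: real assume e0: "e0 > 0"
  define e where "e = e0 / real CARD('n)"
  have e: "e > 0" using e0 by (simp add: e_def)
  have "\<forall>\<^sub>F y in nhds x. dist (g j y) (g j x) < e" for j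
    using cont[of j] e by (simp add: isCont_def tendsto_at_iff_tendsto_nhds tendstoD)
  then have "\<forall>\<^sub>F y in nhds x. ((\<lambda>t. f (y + t *\<^sub>R axis j 1)) has_real_derivative g j y) (at 0)
       \<and> dist (g j y) (g j x) < e" for j
    using g[of j] by (simp add: eventually_conj_iff)
  then have "\<forall>\<^sub>F y in nhds x. \<forall>j. ((\<lambda>t. f (y + t *\<^sub>R axis j 1)) has_real_derivative g j y) (at 0)
       \<and> dist (g j y) (g j x) < e"
    by (rule eventually_all_finite)
  then obtain r where r: "r > 0" and R: "\<And>y j. dist y x < r \<Longrightarrow>
      ((\<lambda>t. f (y + t *\<^sub>R axis j 1)) has_real_derivative g j y) (at 0) \<and> dist (g j y) (g j x) < e"
    unfolding eventually_nhds_metric by blast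
  show "\<exists>d>0. \<forall>y. norm (y - x) < d \<longrightarrow>
      norm (f y - f x - (\<Sum>j\<in>UNIV. g j x * (y - x) $ j)) \<le> e0 * norm (y - x)"
  proof (intro exI[of _ r] conjI r allI impI)
    fix y assume y: "norm (y - x) < r"
    define h where "h = y - x"
    \<comment> \<open>Every point of the broken path differs from \<open>x\<close> by a vector
      dominated coordinatewise by \<open>h\<close>, so the path stays in the ball.\<close>
    have near: "dist (x + (\<Sum>j\<in>J. h $ j *\<^sub>R axis j 1) + t *\<^sub>R axis i 1) x < r"
      if "i \<notin> J" "\<bar>t\<bar> \<le> \<bar>h $ i\<bar>" for J i t
    proof -
      have "norm ((\<Sum>j\<in>J. h $ j *\<^sub>R axis j 1) + t *\<^sub>R axis i 1 :: real^'n) \<le> norm h"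
      proof (rule norm_le_componentwise_cart)
        fix l
        have "(\<Sum>j\<in>J. h $ j *\<^sub>R axis j 1 :: real^'n) $ l = (\<Sum>j\<in>J. if j = l then h $ l else 0)"
          unfolding sum_component by (rule sum.cong) (auto simp: axis_def)
        also have "\<dots> = (if l \<in> J then h $ l else 0)" by simp
        finally have *: "(\<Sum>j\<in>J. h $ j *\<^sub>R axis j 1 :: real^'n) $ l = (if l \<in> J then h $ l else 0)" .
        show "norm (((\<Sum>j\<in>J. h $ j *\<^sub>R axis j 1) + t *\<^sub>R axis i 1 :: real^'n) $ l) \<le> norm (h $ l)"
          unfolding vector_add_component * using that by (auto simp: axis_def)
      qed
      then show ?thesis using y by (simp add: dist_norm h_def add.assoc)
    qed
    have "\<bar>f (x + (\<Sum>j\<in>J. h $ j *\<^sub>R axis j 1)) - f x - (\<Sum>j\<in>J. g j x * h $ j)\<bar> \<le> e * (\<Sum>j\<in>J. \<bar>h $ j\<bar>)"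
      if "finite J" for J
      using that
    proof induction
      case (insert i J)
      let ?z = "x + (\<Sum>j\<in>J. h $ j *\<^sub>R axis j 1)" and ?S = "{-\<bar>h $ i\<bar>..\<bar>h $ i\<bar>}"
      let ?F = "\<lambda>t. f (?z + t *\<^sub>R axis i 1) - g i x * t"
      have "norm (?F (h $ i) - ?F 0) \<le> e * norm (h $ i - 0)"
      proof (rule field_differentiable_bound[where S="?S" and f="?F" and f'="\<lambda>t. g i (?z + t *\<^sub>R axis i 1) - g i x"])
        fix t assume "t \<in> ?S"
        then have n: "dist (?z + t *\<^sub>R axis i 1) x < r" using near[OF insert(2), of t] by auto
        have A: "((\<lambda>t. f (?z + t *\<^sub>R axis i 1)) has_real_derivative g i (?z + t *\<^sub>R axis i 1)) (at t)"
          by (rule has_real_derivative_shift_line) (use R[OF n, of i] in blast)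
        have B: "((\<lambda>t. g i x * t) has_real_derivative g i x) (at t)"
          by (auto intro!: derivative_eq_intros)
        show "(?F has_real_derivative g i (?z + t *\<^sub>R axis i 1) - g i x) (at t within ?S)"
          by (rule has_field_derivative_at_within[OF DERIV_diff[OF A B]])
        show "norm (g i (?z + t *\<^sub>R axis i 1) - g i x) \<le> e"
          using R[OF n, of i] unfolding dist_norm by linarith
      qed auto
      then have "\<bar>f (?z + h $ i *\<^sub>R axis i 1) - f ?z - g i x * h $ i\<bar> \<le> e * \<bar>h $ i\<bar>" by simp
      moreover have "x + (\<Sum>j\<in>insert i J. h $ j *\<^sub>R axis j 1) = ?z + h $ i *\<^sub>R axis i 1"
        using insert(1,2) by (simp add: algebra_simps)
      ultimately show ?case using insert by (simp add: algebra_simps)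
    qed simp
    from this[of UNIV] have "\<bar>f (x + (\<Sum>j\<in>UNIV. h $ j *\<^sub>R axis j 1)) - f x - (\<Sum>j\<in>UNIV. g j x * h $ j)\<bar> \<le> e * (\<Sum>j\<in>UNIV. \<bar>h $ j\<bar>)"
      by simp
    also have "(\<Sum>j\<in>UNIV. h $ j *\<^sub>R axis j 1) = h"
      using basis_expansion[of h] by (simp add: scalar_mult_eq_scaleR)
    also have "(\<Sum>j\<in>UNIV. \<bar>h $ j\<bar>) \<le> real CARD('n) * norm h"
      using sum_bounded_above[of UNIV "\<lambda>j. \<bar>h $ j\<bar>" "norm h"] component_le_norm_cart by auto
    then have "e * (\<Sum>j\<in>UNIV. \<bar>h $ j\<bar>) \<le> e0 * norm h"
      using mult_left_mono[OF _ less_imp_le[OF e]] by (fastforce simp: e_def)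
    finally show "norm (f y - f x - (\<Sum>j\<in>UNIV. g j x * (y - x) $ j)) \<le> e0 * norm (y - x)"
      by (simp add: h_def)
  qed
qed

text \<open>The quadratic form at \<open>w + t z\<close> is a nonnegative quadratic polynomial in \<open>t\<close> without constant term,
  so its linear term vanishes.\<close>

lemma psd_form_zero_imp_kernel:
  fixes N :: "real^'n^'n"
  assumes sym: "transpose N = N" and psd: "\<And>p. p \<bullet> (N *v p) \<ge> 0" and w: "w \<bullet> (N *v w) = 0"
  shows "N *v w = 0"
proof -
  define z where "z = N *v w"
  have "p \<bullet> (N *v q) = q \<bullet> (N *v p)" for p q
    by (metis dot_lmul_matrix inner_commute sym transpose_matrix_vector)
  then have *: "w \<bullet> (N *v z) = z \<bullet> z" by (simp add: z_def)
  define c where "c = z \<bullet> (N *v z)"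
  have q: "0 \<le> 2 * t * (z \<bullet> z) + t\<^sup>2 * c" for t
    using psd[of "w + t *\<^sub>R z"] w *
    by (simp add: matrix_vector_right_distrib matrix_vector_mult_scaleR
        power2_eq_square c_def z_def[symmetric] algebra_simps)
  have c: "c \<ge> 0" unfolding c_def by (rule psd)
  \<comment> \<open>Testing at \<open>t = - r\<close> leaves
    \<open>- r\<^sup>2 * (c + 2) \<ge> 0\<close>; the denominator \<open>c + 1\<close> avoids a
    separate case \<open>c = 0\<close>.\<close>
  define r where "r = (z \<bullet> z) / (c + 1)"
  have "z \<bullet> z = r * (c + 1)" using c by (simp add: r_def)
  with q[of "- r"] have "r\<^sup>2 * (c + 2) \<le> 0" by (simp add: power2_eq_square algebra_simps)
  with c have "r = 0" by (simp add: mult_le_0_iff)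
  with c have "z = 0" by (simp add: r_def)
  then show ?thesis by (simp add: z_def)
qed

text \<open>Compactness gives a minimiser \<open>w\<close> of the form on the unit sphere, with
  value \<open>l\<close>. Then \<open>M - l *\<^sub>R mat 1\<close> is positive semidefinite with
  form zero at \<open>w\<close>, so \<open>w\<close> lies in its kernel.\<close>

lemma symmetric_matrix_least_eigenvalue:
  fixes M :: "real^'n^'n"
  assumes sym: "transpose M = M"
  obtains l where "is_eigenvalue M l" "\<And>p. p \<bullet> (M *v p) \<ge> l * (p \<bullet> p)"
proof -
  have "continuous_on (sphere 0 1) (\<lambda>p::real^'n. p \<bullet> (M *v p))"
    by (intro continuous_intros linear_continuous_on_compose[OF continuous_on_id]) auto
  moreover have "axis undefined 1 \<in> sphere (0::real^'n) 1" by simp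
  ultimately obtain w :: "real^'n" where w: "w \<in> sphere 0 1"
    and min: "\<And>p. p \<in> sphere 0 1 \<Longrightarrow> w \<bullet> (M *v w) \<le> p \<bullet> (M *v p)"
    using continuous_attains_inf[of "sphere (0::real^'n) 1" "\<lambda>p. p \<bullet> (M *v p)"] by (metis compact_sphere empty_iff)
  define l where "l = w \<bullet> (M *v w)"
  have le: "p \<bullet> (M *v p) \<ge> l * (p \<bullet> p)" for p
  proof (cases "p = 0")
    case False
    have "l \<le> (p /\<^sub>R norm p) \<bullet> (M *v (p /\<^sub>R norm p))"
      unfolding l_def by (rule min) (use False in simp)
    also have "\<dots> = (p \<bullet> (M *v p)) / (norm p)\<^sup>2"
      by (simp add: matrix_vector_mult_scaleR power2_eq_square divide_inverse)
    finally show ?thesis using False by (simp add: field_simps dot_square_norm)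
  qed simp
  define N where "N = M - l *\<^sub>R mat 1"
  have N: "N *v p = M *v p - l *\<^sub>R p" for p
    by (simp add: N_def matrix_vector_mult_diff_rdistrib scaleR_matrix_vector_assoc[symmetric])
  have "N *v w = 0"
  proof (rule psd_form_zero_imp_kernel)
    show "transpose N = N" using sym by (simp add: N_def vec_eq_iff transpose_def mat_def)
    show "p \<bullet> (N *v p) \<ge> 0" for p using le[of p] by (simp add: N inner_diff_right)
    show "w \<bullet> (N *v w) = 0" using w by (simp add: N inner_diff_right l_def dot_square_norm)
  qed
  then have "is_eigenvalue M l" unfolding is_eigenvalue_def
    using w by (intro exI[of _ w]) (auto simp: N)
  then show ?thesis using le that by blast
qed

section \<open>Derivatives of the volume\<close>

text \<open>In such a frame the row of \<open>v\<close> is zero except for a positive last entry,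
  the shape demanded by \<open>ineq_vol_Suc\<close>.\<close>

lemma orthonormal_frame_last:
  fixes v :: "'a::euclidean_space"
  assumes v: "v \<noteq> 0" and dim: "DIM('a) = Suc m"
  obtains b where "orthonormal_frame (Suc m) b" "v = norm v *\<^sub>R b m"
proof -
  have "orthonormal_frame 1 (\<lambda>_. v /\<^sub>R norm v)"
    using v by (simp add: orthonormal_frame_def dot_square_norm power2_eq_square)
  then obtain b where b: "orthonormal_frame (Suc m) b" "b 0 = v /\<^sub>R norm v"
    using orthonormal_frame_extend[of 1 _ "Suc m"] dim by (metis le_refl One_nat_def Suc_leI zero_less_Suc zero_less_one)
  show thesis
    by (rule that[of "\<lambda>l. b (Suc m - 1 - l)"]) (use orthonormal_frame_rev[OF b(1)] b(2) v in auto)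
qed

text \<open>Gram-Schmidt on \<open>v\<close>, \<open>u\<close>, placed at the end of the frame.
  After slicing along \<open>v\<close>, the row of \<open>u\<close> in turn has only its last
  remaining entry, so a second slicing is possible; that entry is the length of the part
  \<open>w\<close> of \<open>u\<close> orthogonal to \<open>v\<close>.\<close>

lemma orthonormal_frame_last_two:
  fixes u v :: "'a::euclidean_space"
  assumes v: "v \<noteq> 0" and u: "\<nexists>a. u = a *\<^sub>R v" and dim: "DIM('a) = Suc (Suc m)"
  obtains b where "orthonormal_frame (Suc (Suc m)) b" "v = norm v *\<^sub>R b (Suc m)"
    "u \<bullet> b m > 0" "u = (u \<bullet> b m) *\<^sub>R b m + (u \<bullet> b (Suc m)) *\<^sub>R b (Suc m)"
proof -
  define b0 where "b0 = v /\<^sub>R norm v"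
  have b00: "b0 \<bullet> b0 = 1" and v_eq: "v = norm v *\<^sub>R b0"
    using v by (auto simp: b0_def dot_square_norm power2_eq_square)
  define w where "w = u - (u \<bullet> b0) *\<^sub>R b0"
  have "w \<noteq> 0"
  proof
    assume "w = 0"
    then have "u = ((u \<bullet> b0) / norm v) *\<^sub>R v" by (simp add: w_def b0_def divide_inverse)
    then show False using u by blast
  qed
  define b1 where "b1 = w /\<^sub>R norm w"
  have wb0: "w \<bullet> b0 = 0" by (simp add: w_def inner_diff_left b00)
  have "u \<bullet> w = w \<bullet> w"
    using wb0 by (simp add: w_def inner_diff_left inner_diff_right inner_commute)
  then have ub1: "u \<bullet> b1 = norm w"
    using \<open>w \<noteq> 0\<close> by (simp add: b1_def dot_square_norm power2_eq_square)
  have b1: "b1 \<bullet> b1 = 1" "b1 \<bullet> b0 = 0"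
    using \<open>w \<noteq> 0\<close> wb0 by (auto simp: b1_def dot_square_norm power2_eq_square)
  have u_eq: "u = (u \<bullet> b1) *\<^sub>R b1 + (u \<bullet> b0) *\<^sub>R b0"
    unfolding ub1 using \<open>w \<noteq> 0\<close> by (simp add: b1_def) (simp add: w_def)
  have "orthonormal_frame 2 (\<lambda>l. if l = 0 then b0 else b1)"
    using b00 b1 by (auto simp: orthonormal_frame_def inner_commute)
  then obtain b where b: "orthonormal_frame (Suc (Suc m)) b" "\<forall>l<2. b l = (if l = 0 then b0 else b1)"
    using orthonormal_frame_extend[of 2 "\<lambda>l. if l = 0 then b0 else b1" "Suc (Suc m)"] dim by auto
  then have "b 0 = b0" "b 1 = b1" by auto
  then show thesis
    using that[of "\<lambda>l. b (Suc (Suc m) - 1 - l)"] orthonormal_frame_rev[OF b(1)] v_eq u_eq ub1 \<open>w \<noteq> 0\<close>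
    by (simp add: Suc_diff_le)
qed

section \<open>First partial derivatives of the volume\<close>

lemma closed_poly_P: "closed (poly_P v x)"
proof -
  have "poly_P v x = (\<Inter>i. {p. v i \<bullet> p \<le> x $ i})" by (auto simp: poly_P_def)
  then show ?thesis by (simp add: closed_INT closed_halfspace_le)
qed

lemma measure_poly_P_frame:
  fixes v :: "'n::finite \<Rightarrow> real^'d"
  assumes b: "orthonormal_frame CARD('d) b"
  shows "measure lebesgue (poly_P v x) = ineq_vol CARD('d) UNIV (\<lambda>k l. v k \<bullet> b l) (\<lambda>k. x $ k)"
proof -
  let ?f = "\<lambda>y. \<Sum>l<CARD('d). y l *\<^sub>R b l"
  have P: "poly_P v x \<in> sets borel" by (simp add: closed_poly_P borel_closed)
  have b': "orthonormal_frame DIM(real^'d) b" using b by simp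
  have [measurable]: "?f \<in> coord_lborel CARD('d) \<rightarrow>\<^sub>M borel" by measurable
  have "measure lebesgue (poly_P v x) = measure lborel (poly_P v x)"
    by (rule measure_completion) (use P in simp)
  also have "\<dots> = measure (distr (coord_lborel CARD('d)) borel ?f) (poly_P v x)"
    using lborel_distr_frame[OF b'] by simp
  also have "\<dots> = measure (coord_lborel CARD('d)) (?f -` poly_P v x \<inter> space (coord_lborel CARD('d)))"
    by (rule measure_distr) (use P in auto)
  also have "?f -` poly_P v x \<inter> space (coord_lborel CARD('d)) = ineq_set CARD('d) UNIV (\<lambda>k l. v k \<bullet> b l) (\<lambda>k. x $ k)"
    by (auto simp: ineq_set_def poly_P_def inner_sum_right mult.commute)
  finally show ?thesis by (simp add: ineq_vol_def)
qed

text \<open>Only the normals are fixed, and \<open>norm_bound\<close> holds for every right-hand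
  side; hence volumes can be differentiated at points near \<open>x0\<close> without knowing that
  their polyhedra still have all the facets.\<close>

locale normal_system =
  fixes v :: "'n::finite \<Rightarrow> real^'d" and C :: real
  assumes nonzero: "v i \<noteq> 0"
    and norm_bound: "B > 0 \<Longrightarrow> (\<And>k. v k \<bullet> p \<le> B) \<Longrightarrow> norm p \<le> C * B"
begin

abbreviation vol :: "real^'n \<Rightarrow> real" where
  "vol \<equiv> \<lambda>x. measure lebesgue (poly_P v x)"

abbreviation gradvol :: "'n \<Rightarrow> real^'n \<Rightarrow> real" where
  "gradvol j \<equiv> partial_deriv j vol"

text \<open>On the hyperplane of \<open>j\<close>, a constraint with normal
  \<open>a *\<^sub>R v j\<close> reads \<open>0 \<le> x $ k - a * x $ j\<close>. The degenerate case
  \<open>0 \<le> 0\<close>, where the slice volume may jump, is ruled out for either sign of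
  \<open>a\<close>.\<close>

definition slice_nondeg :: "'n \<Rightarrow> real^'n \<Rightarrow> bool" where
  "slice_nondeg j x \<longleftrightarrow> (\<forall>k a. k \<noteq> j \<longrightarrow> v k = a *\<^sub>R v j \<longrightarrow> x $ k \<noteq> a * x $ j)"

text \<open>The analogue in codimension two, for constraints that become constant where
  \<open>i\<close> and \<open>j\<close> are both equalities.\<close>

definition slice2_nondeg :: "'n \<Rightarrow> 'n \<Rightarrow> real^'n \<Rightarrow> bool" where
  "slice2_nondeg i j x \<longleftrightarrow> (\<forall>k a c. k \<noteq> i \<longrightarrow> k \<noteq> j \<longrightarrow> v k = a *\<^sub>R v i + c *\<^sub>R v j \<longrightarrow>
      x $ k \<noteq> a * x $ i + c * x $ j)"

lemma bounding_frame:
  assumes b: "orthonormal_frame CARD('d) b"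
  shows "bounding CARD('d) UNIV (\<lambda>k l. v k \<bullet> b l) C"
  unfolding bounding_def
proof (intro allI impI)
  fix q :: "nat \<Rightarrow> real" and B :: real and l
  assume B: "B > 0" and q: "\<forall>k\<in>UNIV. (\<Sum>l<CARD('d). v k \<bullet> b l * q l) \<le> B" and l: "l < CARD('d)"
  let ?p = "\<Sum>l<CARD('d). q l *\<^sub>R b l"
  have "norm ?p \<le> C * B"
    by (rule norm_bound[OF B]) (use q in \<open>simp add: inner_sum_right mult.commute\<close>)
  moreover have "?p \<bullet> b l = q l"
    using b l by (simp add: inner_sum_left orthonormal_frame_def if_distrib[of "(*) _"] cong: if_cong)
  moreover have "\<bar>?p \<bullet> b l\<bar> \<le> norm ?p * norm (b l)" by (rule Cauchy_Schwarz_ineq2)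
  ultimately show "\<bar>q l\<bar> \<le> C * B" using orthonormal_frameD(3)[OF b l] by simp
qed

text \<open>The slice of the polyhedron at the last coordinate \<open>x $ j / norm (v j)\<close>. It
  is the facet in coordinates when \<open>b m\<close> is the unit normal of
  \<open>j\<close>.\<close>

definition facet_vol :: "nat \<Rightarrow> (nat \<Rightarrow> real^'d) \<Rightarrow> 'n \<Rightarrow> real^'n \<Rightarrow> real" where
  "facet_vol m b j x = ineq_vol m (UNIV - {j}) (\<lambda>k l. v k \<bullet> b l) (\<lambda>k. x $ k - (v k \<bullet> b m) / norm (v j) * x $ j)"

context
  fixes m b j
  assumes card: "CARD('d) = Suc m" and frame: "orthonormal_frame (Suc m) b"
    and vj: "v j = norm (v j) *\<^sub>R b m"
begin

lemma frame_normal: "v j \<bullet> b m = norm (v j)" "l < m \<Longrightarrow> v j \<bullet> b l = 0"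
  using frame by (subst vj, simp add: orthonormal_frame_def)+

lemma frame_expand: "(\<Sum>l<m. (p \<bullet> b l) *\<^sub>R b l) + (p \<bullet> b m) *\<^sub>R b m = (p :: real^'d)"
  using orthonormal_frame_expand[of b p] frame card by simp

lemma bounding_facet: "bounding m (UNIV - {j}) (\<lambda>k l. v k \<bullet> b l) C"
  using bounding_step[OF bounding_frame[of b, unfolded card], of j] frame frame_normal by auto

text \<open>A row that vanishes on the first \<open>m\<close> coordinates belongs to a multiple of
  \<open>b m\<close>, hence of \<open>v j\<close>.\<close>

lemma slice_coord_nondeg:
  assumes nd: "slice_nondeg j x" and k: "k \<noteq> j"
  shows "(\<exists>l<m. v k \<bullet> b l \<noteq> 0) \<or> x $ k - (v k \<bullet> b m) / norm (v j) * x $ j \<noteq> 0"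
proof (rule ccontr)
  assume "\<not> ?thesis"
  then have *: "\<And>l. l < m \<Longrightarrow> v k \<bullet> b l = 0" "x $ k = (v k \<bullet> b m) / norm (v j) * x $ j" by auto
  define c where "c = v k \<bullet> b m"
  have "v k = c *\<^sub>R b m" using frame_expand[of "v k"] *(1) by (simp add: c_def)
  also have "b m = (1 / norm (v j)) *\<^sub>R v j" by (subst vj) (use nonzero in simp)
  finally have "v k = (c / norm (v j)) *\<^sub>R v j" by (simp add: divide_inverse)
  then show False using nd k *(2) unfolding slice_nondeg_def c_def by blast
qed

lemma DERIV_vol_frame:
  assumes nd: "slice_nondeg j x"
  shows "((\<lambda>t. vol (x + t *\<^sub>R axis j 1)) has_real_derivative facet_vol m b j x / norm (v j)) (at 0)"
proof -
  let ?A = "\<lambda>k l. v k \<bullet> b l" and ?X = "\<lambda>k. x $ k"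
  have "((\<lambda>s. ineq_vol (Suc m) UNIV ?A (?X(j := s))) has_real_derivative
     ineq_vol m (UNIV - {j}) ?A (\<lambda>k. x $ k - ?A k m / ?A j m * x $ j) / ?A j m) (at (x $ j))"
    by (rule ineq_vol_has_derivative)
       (use bounding_frame[of b] frame card frame_normal nonzero slice_coord_nondeg[OF nd] in auto)
  then have "((\<lambda>s. ineq_vol (Suc m) UNIV ?A (?X(j := s))) has_real_derivative
     facet_vol m b j x / norm (v j)) (at (0 + x $ j))"
    by (simp add: frame_normal facet_vol_def)
  then have "((\<lambda>t. ineq_vol (Suc m) UNIV ?A (?X(j := t + x $ j))) has_real_derivative
     facet_vol m b j x / norm (v j)) (at 0)"
    by (simp only: DERIV_shift)
  moreover have "vol (x + t *\<^sub>R axis j 1) = ineq_vol (Suc m) UNIV ?A (?X(j := t + x $ j))" for t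
  proof -
    have X: "($) (x + t *\<^sub>R axis j 1) = ?X(j := t + x $ j)" by (auto simp: axis_def fun_eq_iff)
    show ?thesis using measure_poly_P_frame[of b v "x + t *\<^sub>R axis j 1"] frame unfolding card X by (simp add: fun_upd_def)
  qed
  ultimately show ?thesis by simp
qed

text \<open>The left side does not mention the frame, so the frame may later be adapted to a second
  normal or to a given parametrisation of the facet.\<close>

lemma gradvol_eq_facet_vol: "slice_nondeg j x \<Longrightarrow> gradvol j x = facet_vol m b j x / norm (v j)"
  unfolding partial_deriv_def by (rule DERIV_imp_deriv[OF DERIV_vol_frame])

lemma isCont_facet_vol: "slice_nondeg j x \<Longrightarrow> isCont (facet_vol m b j) x"
  unfolding facet_vol_def
  by (rule isCont_ineq_vol[OF _ bounding_facet])
     (use slice_coord_nondeg nonzero[of j] in \<open>auto intro!: continuous_intros\<close>)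

end

lemma card_Suc: obtains m where "CARD('d) = Suc m"
  using not0_implies_Suc[of "CARD('d)"] by auto

lemma DERIV_vol:
  assumes "slice_nondeg j x"
  shows "((\<lambda>t. vol (x + t *\<^sub>R axis j 1)) has_real_derivative gradvol j x) (at 0)"
proof -
  obtain m where m: "CARD('d) = Suc m" by (rule card_Suc)
  obtain b where b: "orthonormal_frame (Suc m) b" "v j = norm (v j) *\<^sub>R b m"
    using orthonormal_frame_last[OF nonzero, of m j] m by auto
  show ?thesis using DERIV_vol_frame[OF m b assms] gradvol_eq_facet_vol[OF m b assms] by simp
qed

lemma eventually_coord_neq:
  "x $ k \<noteq> a * x $ j + c * x $ i \<Longrightarrow> \<forall>\<^sub>F y in nhds (x :: real^'n). y $ k \<noteq> a * y $ j + c * y $ i"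
  using eventually_nhds_in_open[of "{y. y $ k \<noteq> a * y $ j + c * y $ i}" x]
  by (simp add: open_Collect_neq continuous_intros)

text \<open>As \<open>v j\<close> is nonzero, at most one coefficient \<open>a\<close> is relevant
  for each \<open>k\<close>; finitely many open conditions remain.\<close>

lemma eventually_slice_nondeg:
  assumes "slice_nondeg j x"
  shows "\<forall>\<^sub>F y in nhds x. slice_nondeg j y"
proof -
  have "\<forall>\<^sub>F y in nhds x. \<forall>a. k \<noteq> j \<longrightarrow> v k = a *\<^sub>R v j \<longrightarrow> y $ k \<noteq> a * y $ j" for k
  proof (cases "k \<noteq> j \<and> (\<exists>a. v k = a *\<^sub>R v j)")
    case True
    then obtain a where a: "k \<noteq> j" "v k = a *\<^sub>R v j" by blast
    then have "x $ k \<noteq> a * x $ j + 0 * x $ j" using assms unfolding slice_nondeg_def by auto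
    from eventually_coord_neq[OF this] show ?thesis
    proof eventually_elim
      case (elim y)
      have "a' = a" if "v k = a' *\<^sub>R v j" for a' using that a(2) nonzero[of j] by simp
      then show ?case using elim by auto
    qed
  next
    case False
    then show ?thesis by (intro always_eventually) blast
  qed
  then have "\<forall>\<^sub>F y in nhds x. \<forall>k a. k \<noteq> j \<longrightarrow> v k = a *\<^sub>R v j \<longrightarrow> y $ k \<noteq> a * y $ j"
    by (rule eventually_all_finite)
  then show ?thesis unfolding slice_nondeg_def .
qed

lemma isCont_gradvol:
  assumes "slice_nondeg j x"
  shows "isCont (gradvol j) x"
proof -
  obtain m where m: "CARD('d) = Suc m" by (rule card_Suc)
  obtain b where b: "orthonormal_frame (Suc m) b" "v j = norm (v j) *\<^sub>R b m"
    using orthonormal_frame_last[OF nonzero, of m j] m by auto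
  have "\<forall>\<^sub>F y in nhds x. gradvol j y = facet_vol m b j y / norm (v j)"
    using eventually_slice_nondeg[OF assms] by eventually_elim (rule gradvol_eq_facet_vol[OF m b])
  moreover have "isCont (\<lambda>y. facet_vol m b j y / norm (v j)) x"
    using isCont_facet_vol[OF m b assms] nonzero[of j] by (intro continuous_intros) auto
  ultimately show ?thesis by (simp add: isCont_cong)
qed

end

text \<open>A zero row acts only through the sign of its bound. This is what makes a facet
  insensitive to small shifts of a parallel constraint.\<close>

lemma ineq_set_cong_trivial_rows:
  assumes "\<And>k. k \<in> I \<Longrightarrow> x k = x' k \<or> (\<forall>l<m. A k l = 0) \<and> (0 \<le> x k \<longleftrightarrow> 0 \<le> x' k)"
  shows "ineq_set m I A x = ineq_set m I A x'"
proof -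
  have "(\<Sum>l<m. A k l * y l) \<le> x k \<longleftrightarrow> (\<Sum>l<m. A k l * y l) \<le> x' k" if k: "k \<in> I" for y k
  proof (cases "x k = x' k")
    case False
    then have "\<forall>l<m. A k l = 0" "0 \<le> x k \<longleftrightarrow> 0 \<le> x' k" using assms[OF k] by auto
    then show ?thesis by simp
  qed simp
  then show ?thesis unfolding ineq_set_def by blast
qed

section \<open>Mixed second derivatives\<close>

context normal_system
begin

text \<open>Independence of \<open>v i\<close> and \<open>v j\<close> makes the coefficients
  \<open>a\<close>, \<open>c\<close> unique for each \<open>k\<close>; for parallel normals
  infinitely many conditions could arise.\<close>

lemma eventually_slice2_nondeg:
  assumes nd: "slice2_nondeg i j x" and ind: "\<nexists>a. v i = a *\<^sub>R v j"
  shows "\<forall>\<^sub>F y in nhds x. slice2_nondeg i j y"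
proof -
  have "\<forall>\<^sub>F y in nhds x. \<forall>a c. k \<noteq> i \<longrightarrow> k \<noteq> j \<longrightarrow> v k = a *\<^sub>R v i + c *\<^sub>R v j \<longrightarrow>
      y $ k \<noteq> a * y $ i + c * y $ j" for k
  proof (cases "k \<noteq> i \<and> k \<noteq> j \<and> (\<exists>a c. v k = a *\<^sub>R v i + c *\<^sub>R v j)")
    case True
    then obtain a c where a: "k \<noteq> i" "k \<noteq> j" "v k = a *\<^sub>R v i + c *\<^sub>R v j" by blast
    then have "x $ k \<noteq> a * x $ i + c * x $ j" using nd unfolding slice2_nondeg_def by auto
    from eventually_coord_neq[OF this] show ?thesis
    proof eventually_elim
      case (elim y)
      have "a' = a \<and> c' = c" if "v k = a' *\<^sub>R v i + c' *\<^sub>R v j" for a' c'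
      proof -
        have eq: "(a' - a) *\<^sub>R v i = (c - c') *\<^sub>R v j"
          using that a(3) by (simp add: algebra_simps)
        have "a' = a"
        proof (rule ccontr)
          assume "a' \<noteq> a"
          then have "v i = ((c - c') / (a' - a)) *\<^sub>R v j"
            using arg_cong[OF eq, of "\<lambda>z. (1 / (a' - a)) *\<^sub>R z"] by simp
          then show False using ind by blast
        qed
        then show ?thesis using eq nonzero[of j] by simp
      qed
      then show ?case using elim by auto
    qed
  next
    case False
    then show ?thesis by (intro always_eventually) blast
  qed
  then have "\<forall>\<^sub>F y in nhds x. \<forall>k a c. k \<noteq> i \<longrightarrow> k \<noteq> j \<longrightarrow> v k = a *\<^sub>R v i + c *\<^sub>R v j \<longrightarrow>
      y $ k \<noteq> a * y $ i + c * y $ j"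
    by (rule eventually_all_finite)
  then show ?thesis unfolding slice2_nondeg_def .
qed

lemma DERIV_gradvol_via_frame:
  assumes m: "CARD('d) = Suc m" and b: "orthonormal_frame (Suc m) b" "v j = norm (v j) *\<^sub>R b m"
    and nd: "slice_nondeg j y"
    and D: "((\<lambda>t. facet_vol m b j (y + t *\<^sub>R axis i 1)) has_real_derivative D) (at 0)"
  shows "((\<lambda>t. gradvol j (y + t *\<^sub>R axis i 1)) has_real_derivative D / norm (v j)) (at 0)"
proof -
  have "\<forall>\<^sub>F t in nhds 0. gradvol j (y + t *\<^sub>R axis i 1) = facet_vol m b j (y + t *\<^sub>R axis i 1) / norm (v j)"
    using eventually_line_nhds[OF eventually_slice_nondeg[OF nd]]
    by eventually_elim (rule gradvol_eq_facet_vol[OF m b])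
  then show ?thesis using DERIV_cdivide[OF D] by (subst DERIV_cong_ev[OF refl _ refl])
qed

text \<open>On the hyperplane of \<open>j\<close>, constraint \<open>i\<close> is constantly true or
  constantly false with a nonzero bound \<open>X y i\<close>. Shifts smaller than
  \<open>\<bar>X y i\<bar>\<close> keep the sign of that bound, so the slice does not
  change.\<close>

lemma mixed_derivative_parallel:
  assumes ij: "i \<noteq> j" and nd: "slice_nondeg j y" and par: "v i = a *\<^sub>R v j"
  shows "((\<lambda>t. gradvol j (y + t *\<^sub>R axis i 1)) has_real_derivative 0) (at 0)"
proof -
  obtain m where m: "CARD('d) = Suc m" by (rule card_Suc)
  obtain b where b: "orthonormal_frame (Suc m) b" "v j = norm (v j) *\<^sub>R b m"
    using orthonormal_frame_last[OF nonzero, of m j] m by auto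
  define X where "X z k = z $ k - (v k \<bullet> b m) / norm (v j) * z $ j" for z :: "real^'n" and k
  have vi: "v i \<bullet> b l = 0" if "l < m" for l using frame_normal(2)[OF m b that] par by simp
  then have Xi: "X y i \<noteq> 0" using slice_coord_nondeg[OF m b nd ij] unfolding X_def by auto
  have X_upd: "X (y + t *\<^sub>R axis i 1) k = (if k = i then X y i + t else X y k)" for t k
    using ij by (auto simp: X_def axis_def)
  have "facet_vol m b j (y + t *\<^sub>R axis i 1) = facet_vol m b j y" if "\<bar>t\<bar> < \<bar>X y i\<bar>" for t
    unfolding facet_vol_def X_def[symmetric] ineq_vol_def
    by (intro arg_cong[where f="measure _"] ineq_set_cong_trivial_rows)
       (use that vi in \<open>auto simp: X_upd\<close>)
  then have "\<forall>\<^sub>F t in nhds 0. facet_vol m b j (y + t *\<^sub>R axis i 1) = facet_vol m b j y"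
    unfolding eventually_nhds_metric using Xi by (intro exI[of _ "\<bar>X y i\<bar>"]) auto
  then have "((\<lambda>t. facet_vol m b j (y + t *\<^sub>R axis i 1)) has_real_derivative 0) (at 0)"
    by (subst DERIV_cong_ev[OF refl _ refl]) auto
  from DERIV_gradvol_via_frame[OF m b nd this] show ?thesis by simp
qed

text \<open>For independent normals the facet volume is itself an \<open>ineq_vol\<close> in which
  row \<open>i\<close> can be sliced off again. Parallel normals admit no second slicing and give
  derivative 0.\<close>

lemma mixed_derivative_exists:
  assumes ij: "i \<noteq> j" and nd: "slice_nondeg j x" and nd2: "slice2_nondeg i j x"
  obtains D where "\<forall>\<^sub>F y in nhds x. ((\<lambda>t. gradvol j (y + t *\<^sub>R axis i 1)) has_real_derivative D y) (at 0)"
    "isCont D x"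
proof (cases "\<exists>a. v i = a *\<^sub>R v j")
  case True
  have "\<forall>\<^sub>F y in nhds x. ((\<lambda>t. gradvol j (y + t *\<^sub>R axis i 1)) has_real_derivative 0) (at 0)"
    using eventually_slice_nondeg[OF nd]
    by eventually_elim (use mixed_derivative_parallel[OF ij] True in blast)
  then show ?thesis using that[of "\<lambda>_. 0"] by simp
next
  case ind: False
  have "CARD('d) \<ge> 2"
  proof -
    have "card {v i, v j} = 2" using ind by (metis card_2_iff scaleR_one)
    moreover have "independent {v i, v j}"
      using ind nonzero[of j] by (auto simp: independent_insert span_singleton)
    ultimately show ?thesis using independent_bound[of "{v i, v j}"] by simp
  qed
  then obtain m where m: "CARD('d) = Suc (Suc m)"
    by (metis Suc_le_D numeral_2_eq_2 Suc_le_mono)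
  obtain b where b: "orthonormal_frame (Suc (Suc m)) b" "v j = norm (v j) *\<^sub>R b (Suc m)"
    and vi: "v i \<bullet> b m > 0" "v i = (v i \<bullet> b m) *\<^sub>R b m + (v i \<bullet> b (Suc m)) *\<^sub>R b (Suc m)"
    using orthonormal_frame_last_two[OF nonzero ind, of m] m by auto
  have vi0: "v i \<bullet> b l = 0" if "l < m" for l
    by (subst vi(2)) (use b(1) that in \<open>simp add: inner_add_left orthonormal_frame_def\<close>)
  let ?A = "\<lambda>k l. v k \<bullet> b l"
  define X where "X z k = z $ k - ?A k (Suc m) / norm (v j) * z $ j" for z :: "real^'n" and k
  \<comment> \<open>Volume of the part of \<open>poly_P v z\<close> where \<open>i\<close> and
    \<open>j\<close> are equalities, divided by the length \<open>?A i m\<close> of the component of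
    \<open>v i\<close> orthogonal to \<open>v j\<close>.\<close>
  define D where "D z = ineq_vol m (UNIV - {j} - {i}) ?A (\<lambda>k. X z k - ?A k m / ?A i m * X z i) / ?A i m" for z
  have nondeg: "(\<exists>l<m. ?A k l \<noteq> 0) \<or> X z k - ?A k m / ?A i m * X z i \<noteq> 0"
    if nd: "slice2_nondeg i j z" and k: "k \<noteq> i" "k \<noteq> j" for z k
  proof (rule ccontr)
    assume "\<not> ?thesis"
    then have *: "\<And>l. l < m \<Longrightarrow> ?A k l = 0" "X z k = ?A k m / ?A i m * X z i" by auto
    define p q r s where "p = ?A k m" and "q = ?A k (Suc m)" and "r = ?A i m" and "s = ?A i (Suc m)"
    have r: "r > 0" using vi(1) by (simp add: r_def)
    have nj: "norm (v j) > 0" using nonzero by simp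
    have vk: "v k = p *\<^sub>R b m + q *\<^sub>R b (Suc m)"
      using frame_expand[OF m b, of "v k"] *(1) by (simp add: p_def q_def)
    have vi': "v i = r *\<^sub>R b m + s *\<^sub>R b (Suc m)" using vi(2) by (simp add: r_def s_def)
    \<comment> \<open>The multiple of \<open>v i\<close> is chosen to match the \<open>b m\<close>
      component; what is left is a multiple of \<open>b (Suc m)\<close>, hence of
      \<open>v j\<close>.\<close>
    have "(p / r) *\<^sub>R v i + ((q - p / r * s) / norm (v j)) *\<^sub>R (norm (v j) *\<^sub>R b (Suc m)) = v k"
      unfolding vk vi' using r nj by (simp add: scaleR_add_right scaleR_diff_left)
    then have "v k = (p / r) *\<^sub>R v i + ((q - p / r * s) / norm (v j)) *\<^sub>R v j" using b(2) by simp
    then have "z $ k \<noteq> (p / r) * z $ i + ((q - p / r * s) / norm (v j)) * z $ j"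
      using nd k unfolding slice2_nondeg_def by blast
    moreover have "z $ k - q / norm (v j) * z $ j = p / r * (z $ i - s / norm (v j) * z $ j)"
      using *(2) unfolding X_def p_def q_def r_def s_def .
    ultimately show False by (simp add: diff_divide_distrib algebra_simps)
  qed
  have bd: "bounding (Suc m) (UNIV - {j}) ?A C" by (rule bounding_facet[OF m b])
  have deriv: "((\<lambda>t. facet_vol (Suc m) b j (z + t *\<^sub>R axis i 1)) has_real_derivative D z) (at 0)"
    if nd: "slice2_nondeg i j z" for z
  proof -
    have "((\<lambda>s. ineq_vol (Suc m) (UNIV - {j}) ?A ((X z)(i := s))) has_real_derivative D z) (at (0 + X z i))"
      unfolding D_def add_0
      by (rule ineq_vol_has_derivative[OF _ bd]) (use ij vi0 vi(1) nondeg[OF nd] in auto)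
    then have "((\<lambda>t. ineq_vol (Suc m) (UNIV - {j}) ?A ((X z)(i := t + X z i))) has_real_derivative D z) (at 0)"
      by (simp only: DERIV_shift)
    moreover have "X (z + t *\<^sub>R axis i 1) = (X z)(i := t + X z i)" for t
      using ij by (auto simp: X_def axis_def)
    ultimately show ?thesis unfolding facet_vol_def by (simp add: X_def[abs_def])
  qed
  have "\<forall>\<^sub>F y in nhds x. ((\<lambda>t. gradvol j (y + t *\<^sub>R axis i 1)) has_real_derivative D y / norm (v j)) (at 0)"
    using eventually_slice_nondeg[OF nd] eventually_slice2_nondeg[OF nd2 ind]
    by eventually_elim (rule DERIV_gradvol_via_frame[OF m b _ deriv])
  moreover have "isCont D x" unfolding D_def
  proof (rule continuous_divide)
    show "isCont (\<lambda>z. ineq_vol m (UNIV - {j} - {i}) ?A (\<lambda>k. X z k - ?A k m / ?A i m * X z i)) x"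
      by (rule isCont_ineq_vol[OF _ bounding_step[OF bd vi0]])
         (use nondeg[OF nd2] vi(1) nonzero[of j] in \<open>auto simp: X_def[abs_def] intro!: continuous_intros\<close>)
  qed (use vi(1) in auto)
  then have "isCont (\<lambda>y. D y / norm (v j)) x" using nonzero[of j] by (intro continuous_intros) auto
  ultimately show ?thesis by (rule that)
qed

end

section \<open>Scaling, translation and Euler's identities\<close>

lemma has_derivative_along_line:
  fixes f :: "'a::real_normed_vector \<Rightarrow> real"
  assumes "(f has_derivative f') (at y)"
  shows "((\<lambda>t. f (y + t *\<^sub>R h)) has_real_derivative f' h) (at 0)"
proof -
  have "((\<lambda>t. y + t *\<^sub>R h) has_derivative (\<lambda>t. t *\<^sub>R h)) (at (0::real))"
    using has_derivative_add[OF has_derivative_const has_derivative_scaleR_left[OF has_derivative_ident]]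
    by simp
  then have "((\<lambda>t. f (y + t *\<^sub>R h)) has_derivative (\<lambda>t. f' (t *\<^sub>R h))) (at 0)"
    by (rule has_derivative_compose[where g=f and g'=f']) (use assms in simp)
  moreover have "f' (t *\<^sub>R h) = f' h * t" for t
    using linear_scale[OF has_derivative_linear[OF assms]] by simp
  ultimately show ?thesis by (simp add: has_field_derivative_def)
qed

lemma measure_poly_P_scale:
  fixes v :: "'n::finite \<Rightarrow> real^'d"
  assumes "t > 0"
  shows "measure lebesgue (poly_P v (t *\<^sub>R x)) = t ^ CARD('d) * measure lebesgue (poly_P v x)"
proof -
  have *: "p \<in> poly_P v (t *\<^sub>R x) \<longleftrightarrow> (1 / t) *\<^sub>R p \<in> poly_P v x" for p
    using assms by (simp add: poly_P_def field_simps)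
  have "poly_P v (t *\<^sub>R x) = (\<lambda>p. t *\<^sub>R p + 0) ` poly_P v x"
  proof (intro equalityI subsetI)
    fix p assume "p \<in> poly_P v (t *\<^sub>R x)"
    then show "p \<in> (\<lambda>p. t *\<^sub>R p + 0) ` poly_P v x"
      using assms by (intro image_eqI[of _ _ "(1 / t) *\<^sub>R p"]) (simp_all add: *)
  next
    fix q assume "q \<in> (\<lambda>p. t *\<^sub>R p + 0) ` poly_P v x"
    then show "q \<in> poly_P v (t *\<^sub>R x)" using assms by (clarsimp simp: *)
  qed
  then show ?thesis using measure_lebesgue_affine[of t "0::real^'d" "poly_P v x"] assms by simp
qed

lemma measure_poly_P_translate:
  "measure lebesgue (poly_P v (x + (\<chi> k. v k \<bullet> p))) = measure lebesgue (poly_P v x)"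
proof -
  have *: "q \<in> poly_P v (x + (\<chi> k. v k \<bullet> p)) \<longleftrightarrow> q - p \<in> poly_P v x" for q
    by (simp add: poly_P_def inner_diff_right algebra_simps)
  have "poly_P v (x + (\<chi> k. v k \<bullet> p)) = (+) p ` poly_P v x"
  proof (intro equalityI subsetI)
    fix q assume "q \<in> poly_P v (x + (\<chi> k. v k \<bullet> p))"
    then show "q \<in> (+) p ` poly_P v x" by (intro image_eqI[of _ _ "q - p"]) (simp_all add: *)
  next
    fix q assume "q \<in> (+) p ` poly_P v x"
    then show "q \<in> poly_P v (x + (\<chi> k. v k \<bullet> p))" by (clarsimp simp: *)
  qed
  then show ?thesis by (simp add: measure_translation)
qed

context normal_system
begin

text \<open>Demanded only at the point where second derivatives are taken; the neighbourhoods come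
  from the openness lemmas.\<close>

definition regular :: "real^'n \<Rightarrow> bool" where
  "regular x \<longleftrightarrow> (\<forall>j. slice_nondeg j x) \<and> (\<forall>i j. i \<noteq> j \<longrightarrow> slice2_nondeg i j x)"

lemma eventually_all_slice_nondeg:
  "(\<forall>j. slice_nondeg j x) \<Longrightarrow> \<forall>\<^sub>F y in nhds x. \<forall>j. slice_nondeg j y"
  by (rule eventually_all_finite) (simp add: eventually_slice_nondeg)

text \<open>Scaling and translation move all coordinates at once, so partial derivatives alone would
  not do.\<close>

lemma vol_has_derivative:
  assumes "\<forall>j. slice_nondeg j x"
  shows "(vol has_derivative (\<lambda>h. \<Sum>j\<in>UNIV. gradvol j x * h $ j)) (at x)"
proof (rule has_derivative_continuous_partials)
  show "\<forall>\<^sub>F y in nhds x. ((\<lambda>t. vol (y + t *\<^sub>R axis j 1)) has_real_derivative gradvol j y) (at 0)" for j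
    using eventually_all_slice_nondeg[OF assms] by eventually_elim (simp add: DERIV_vol)
  show "isCont (gradvol j) x" for j using assms by (simp add: isCont_gradvol)
qed

lemma euler_vol:
  assumes "\<forall>j. slice_nondeg j x"
  shows "(\<Sum>j\<in>UNIV. gradvol j x * x $ j) = real CARD('d) * vol x"
proof -
  have "((\<lambda>t. vol (x + t *\<^sub>R x)) has_real_derivative (\<Sum>j\<in>UNIV. gradvol j x * x $ j)) (at 0)"
    by (rule has_derivative_along_line[OF vol_has_derivative[OF assms]])
  moreover have "((\<lambda>t. vol (x + t *\<^sub>R x)) has_real_derivative real CARD('d) * vol x) (at 0)"
  proof -
    have "\<forall>\<^sub>F t in nhds (0::real). vol (x + t *\<^sub>R x) = (1 + t) ^ CARD('d) * vol x"
      unfolding eventually_nhds_metric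
    proof (intro exI[of _ 1] conjI allI impI)
      fix t :: real assume "dist t 0 < 1"
      then have "1 + t > 0" by (auto simp: dist_real_def)
      then show "vol (x + t *\<^sub>R x) = (1 + t) ^ CARD('d) * vol x"
        using measure_poly_P_scale[of "1 + t" v x] by (simp add: scaleR_add_left)
    qed simp
    moreover have "((\<lambda>t. (1 + t) ^ CARD('d) * vol x) has_real_derivative real CARD('d) * vol x) (at 0)"
      by (auto intro!: derivative_eq_intros)
    ultimately show ?thesis by (subst DERIV_cong_ev[OF refl _ refl])
  qed
  ultimately show ?thesis by (rule DERIV_unique)
qed

text \<open>Minkowski's relation: the unit normals weighted with the facet volumes sum to zero. It
  is the derivative of translation invariance in direction \<open>p\<close>.\<close>

lemma gradvol_translate:
  assumes "\<forall>j. slice_nondeg j x"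
  shows "(\<Sum>j\<in>UNIV. gradvol j x * (v j \<bullet> p)) = 0"
proof -
  have "((\<lambda>t. vol (x + t *\<^sub>R (\<chi> k. v k \<bullet> p))) has_real_derivative (\<Sum>j\<in>UNIV. gradvol j x * (\<chi> k. v k \<bullet> p) $ j)) (at 0)"
    by (rule has_derivative_along_line[OF vol_has_derivative[OF assms]])
  moreover have "vol (x + t *\<^sub>R (\<chi> k. v k \<bullet> p)) = vol x" for t
  proof -
    have "t *\<^sub>R (\<chi> k. v k \<bullet> p) = (\<chi> k. v k \<bullet> (t *\<^sub>R p))" by (simp add: vec_eq_iff)
    then show ?thesis by (simp only: measure_poly_P_translate)
  qed
  ultimately have "((\<lambda>t::real. vol x) has_real_derivative (\<Sum>j\<in>UNIV. gradvol j x * (v j \<bullet> p))) (at 0)"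
    by simp
  from DERIV_unique[OF this DERIV_const] show ?thesis .
qed

text \<open>\<open>D\<close> is computed by slicing for one order of differentiation only;
  \<open>mixed_derivative_swap\<close> then gives existence and the same value for the
  other.\<close>

lemma DERIV_gradvol_offdiag:
  assumes "regular x" "i \<noteq> j"
  shows "((\<lambda>t. gradvol j (x + t *\<^sub>R axis i 1)) has_real_derivative partial_deriv i (gradvol j) x) (at 0)"
    and "partial_deriv i (gradvol j) x = partial_deriv j (gradvol i) x"
proof -
  have nd: "\<forall>j. slice_nondeg j x" using assms(1) by (simp add: regular_def)
  obtain D where D: "\<forall>\<^sub>F y in nhds x. ((\<lambda>t. gradvol j (y + t *\<^sub>R axis i 1)) has_real_derivative D y) (at 0)"
    "isCont D x"
    using mixed_derivative_exists[of i j x] assms unfolding regular_def by blast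
  have D1: "((\<lambda>t. gradvol j (x + t *\<^sub>R axis i 1)) has_real_derivative D x) (at 0)"
    using eventually_nhds_x_imp_x[OF D(1)] .
  have "\<forall>\<^sub>F y in nhds x. ((\<lambda>t. vol (y + t *\<^sub>R axis l 1)) has_real_derivative gradvol l y) (at 0)" for l
    using eventually_all_slice_nondeg[OF nd] by eventually_elim (simp add: DERIV_vol)
  then have D2: "((\<lambda>t. gradvol i (x + t *\<^sub>R axis j 1)) has_real_derivative D x) (at 0)"
    by (intro mixed_derivative_swap[where f=vol, OF _ _ D])
  have "partial_deriv i (gradvol j) x = D x" "partial_deriv j (gradvol i) x = D x"
    by (simp_all only: partial_deriv_def[of i "gradvol j"] partial_deriv_def[of j "gradvol i"]
        DERIV_imp_deriv[OF D1] DERIV_imp_deriv[OF D2])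
  with D1 show "((\<lambda>t. gradvol j (x + t *\<^sub>R axis i 1)) has_real_derivative partial_deriv i (gradvol j) x) (at 0)"
    and "partial_deriv i (gradvol j) x = partial_deriv j (gradvol i) x" by simp_all
qed

text \<open>The diagonal second derivatives exist because translation invariance expresses \<open>gradvol i\<close>
  through the other partial derivatives.\<close>

lemma DERIV_gradvol:
  assumes "regular x"
  shows "((\<lambda>t. gradvol j (x + t *\<^sub>R axis i 1)) has_real_derivative partial_deriv i (gradvol j) x) (at 0)"
proof (cases "i = j")
  case False
  then show ?thesis by (rule DERIV_gradvol_offdiag(1)[OF assms])
next
  case True
  have nd: "\<forall>j. slice_nondeg j x" using assms by (simp add: regular_def)
  \<comment> \<open>Minkowski's relation tested against \<open>p = v i\<close>, where
    \<open>gradvol i\<close> has the nonzero coefficient \<open>v i \<bullet> v i\<close>.\<close>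
  let ?R = "\<lambda>y. - (\<Sum>k\<in>UNIV - {i}. gradvol k y * (v k \<bullet> v i)) / (v i \<bullet> v i)"
  have "gradvol i y = ?R y" if "\<forall>j. slice_nondeg j y" for y
  proof -
    have "gradvol i y * (v i \<bullet> v i) + (\<Sum>k\<in>UNIV - {i}. gradvol k y * (v k \<bullet> v i)) = 0"
      using gradvol_translate[OF that, of "v i"] by (simp add: sum.remove[of UNIV i])
    then show ?thesis using nonzero[of i] by (simp add: field_simps)
  qed
  then have "\<forall>\<^sub>F t in nhds 0. gradvol i (x + t *\<^sub>R axis i 1) = ?R (x + t *\<^sub>R axis i 1)"
    using eventually_line_nhds[OF eventually_all_slice_nondeg[OF nd], of "axis i 1"]
    by (auto elim: eventually_mono)
  moreover obtain D where "((\<lambda>t. ?R (x + t *\<^sub>R axis i 1)) has_real_derivative D) (at 0)"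
  proof -
    have "((\<lambda>t. \<Sum>k\<in>UNIV - {i}. gradvol k (x + t *\<^sub>R axis i 1) * (v k \<bullet> v i)) has_real_derivative
      (\<Sum>k\<in>UNIV - {i}. partial_deriv i (gradvol k) x * (v k \<bullet> v i))) (at 0)"
      by (intro DERIV_sum DERIV_cmult_right DERIV_gradvol_offdiag(1)[OF assms]) auto
    from that[OF DERIV_cdivide[OF DERIV_minus[OF this]]] show thesis .
  qed
  ultimately have D: "((\<lambda>t. gradvol i (x + t *\<^sub>R axis i 1)) has_real_derivative D) (at 0)"
    by (subst DERIV_cong_ev[OF refl _ refl])
  then have "partial_deriv i (gradvol i) x = D"
    by (simp only: partial_deriv_def[of i "gradvol i"] DERIV_imp_deriv)
  then show ?thesis using D True by simp
qed

lemma hessian_symmetric: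
  assumes "regular x"
  shows "partial_deriv i (gradvol j) x = partial_deriv j (gradvol i) x"
  using DERIV_gradvol_offdiag(2)[OF assms] by (cases "i = j") auto

text \<open>Euler's identity for \<open>vol\<close> is differentiated along axis \<open>i\<close>.
  The product rule contributes one extra \<open>gradvol i x\<close>, which lowers the degree from
  \<open>CARD('d)\<close> by one.\<close>

lemma euler_gradvol:
  assumes "regular x"
  shows "(\<Sum>j\<in>UNIV. x $ j * partial_deriv i (gradvol j) x) = (real CARD('d) - 1) * gradvol i x"
proof -
  have nd: "\<forall>j. slice_nondeg j x" using assms by (simp add: regular_def)
  let ?y = "\<lambda>t. x + t *\<^sub>R axis i 1"
  have "\<forall>\<^sub>F t in nhds 0. (\<Sum>j\<in>UNIV. gradvol j (?y t) * ?y t $ j) = real CARD('d) * vol (?y t)"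
    using eventually_line_nhds[OF eventually_all_slice_nondeg[OF nd], of "axis i 1"]
    by eventually_elim (rule euler_vol)
  moreover have "((\<lambda>t. real CARD('d) * vol (?y t)) has_real_derivative real CARD('d) * gradvol i x) (at 0)"
    using nd by (intro DERIV_cmult DERIV_vol) auto
  ultimately have 1: "((\<lambda>t. \<Sum>j\<in>UNIV. gradvol j (?y t) * ?y t $ j) has_real_derivative real CARD('d) * gradvol i x) (at 0)"
    by (subst DERIV_cong_ev[OF refl _ refl])
  have y: "((\<lambda>t. ?y t $ j) has_real_derivative axis i 1 $ j) (at 0)" for j
    by (auto intro!: derivative_eq_intros)
  have "((\<lambda>t. \<Sum>j\<in>UNIV. gradvol j (?y t) * ?y t $ j) has_real_derivative
     (\<Sum>j\<in>UNIV. partial_deriv i (gradvol j) x * ?y 0 $ j + axis i 1 $ j * gradvol j (?y 0))) (at 0)"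
    by (intro DERIV_sum DERIV_mult DERIV_gradvol[OF assms] y)
  from DERIV_unique[OF 1 this]
  have "real CARD('d) * gradvol i x = (\<Sum>j\<in>UNIV. x $ j * partial_deriv i (gradvol j) x) + (\<Sum>j\<in>UNIV. axis i 1 $ j * gradvol j x)"
    by (simp add: sum.distrib mult.commute)
  also have "(\<Sum>j\<in>UNIV. axis i 1 $ j * gradvol j x) = gradvol i x"
    by (simp add: axis_def if_distrib[of "\<lambda>c. c * _"] cong: if_cong)
  finally show ?thesis by (simp add: algebra_simps)
qed

end

section \<open>Facets\<close>

text \<open>A constraint that is a nonnegative combination of two others (both in normal and bound)
  has its facet contained in theirs.\<close>

lemma facet_not_combination:
  fixes v :: "'n::finite \<Rightarrow> real^'d"
  assumes N: "has_outer_facet_normals v x" and k: "k \<noteq> i" "k \<noteq> j"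
    and vk: "v k = a *\<^sub>R v i + c *\<^sub>R v j" and xk: "x $ k = a * x $ i + c * x $ j"
    and ac: "a \<ge> 0" "c \<ge> 0"
  shows False
proof -
  have contained: False if "face_F v k x \<subseteq> face_F v l x" "k \<noteq> l" for l
  proof -
    have F: "face_F v k x facet_of poly_P v x" "face_F v l x facet_of poly_P v x"
      and P: "convex (poly_P v x)" and inj: "inj (\<lambda>i. face_F v i x)"
      using N by (auto simp: has_outer_facet_normals_def polytope_imp_convex)
    have "face_F v k x face_of face_F v l x"
      using F that(1) by (meson face_of_subset facet_of_imp_face_of facet_of_imp_subset)
    moreover have "face_F v k x \<noteq> face_F v l x" using inj that(2) by (auto dest: injD)
    moreover have "convex (face_F v l x)"
      using F(2) by (meson face_of_imp_convex facet_of_imp_face_of)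
    ultimately have "aff_dim (face_F v k x) < aff_dim (face_F v l x)"
      by (intro face_of_aff_dim_lt)
    then show False using F by (simp add: facet_of_def)
  qed
  \<comment> \<open>On the facet of \<open>k\<close> the weighted slacks of \<open>i\<close> and
    \<open>j\<close> are nonnegative with sum zero. A positive weight, which exists because
    \<open>v k\<close> is nonzero, then forces the corresponding constraint to be tight.\<close>
  have split: "a * (x $ i - v i \<bullet> p) = 0 \<and> c * (x $ j - v j \<bullet> p) = 0" if "p \<in> face_F v k x" for p
  proof -
    have "v i \<bullet> p \<le> x $ i" "v j \<bullet> p \<le> x $ j" "v k \<bullet> p = x $ k"
      using that by (auto simp: face_F_def poly_P_def)
    then have "a * (x $ i - v i \<bullet> p) + c * (x $ j - v j \<bullet> p) = 0"
      "a * (x $ i - v i \<bullet> p) \<ge> 0" "c * (x $ j - v j \<bullet> p) \<ge> 0"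
      using vk xk ac by (auto simp: inner_add_left algebra_simps mult_left_mono)
    then show ?thesis by linarith
  qed
  have "v k \<noteq> 0" using N by (simp add: has_outer_facet_normals_def)
  then consider "a > 0" | "c > 0" using vk ac by force
  then show False
  proof cases
    case 1
    then have "face_F v k x \<subseteq> face_F v i x" using split by (force simp: face_F_def)
    then show False using contained k by blast
  next
    case 2
    then have "face_F v k x \<subseteq> face_F v j x" using split by (force simp: face_F_def)
    then show False using contained k by blast
  qed
qed

lemma outer_facet_normals_interior:
  fixes v :: "'n::finite \<Rightarrow> real^'d"
  assumes N: "has_outer_facet_normals v x"
  obtains z e where "e > 0" "ball z e \<subseteq> poly_P v x" "\<And>k. v k \<bullet> z < x $ k"
proof -
  have P: "convex (poly_P v x)" "aff_dim (poly_P v x) = int DIM(real^'d)"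
    using N by (auto simp: has_outer_facet_normals_def polytope_imp_convex)
  have "poly_P v x \<noteq> {}" using P(2) by (metis aff_dim_empty of_nat_0_le_iff not_one_le_zero neg_0_le_iff_le)
  then have "interior (poly_P v x) \<noteq> {}"
    using rel_interior_eq_empty[OF P(1)] interior_rel_interior[OF P(2)] by simp
  then obtain z e where ze: "e > 0" "ball z e \<subseteq> poly_P v x"
    by (meson all_not_in_conv mem_interior)
  have "v k \<bullet> z < x $ k" for k
  proof -
    have vk: "norm (v k) > 0" using N by (simp add: has_outer_facet_normals_def)
    define p where "p = z + (e / 2 / norm (v k)) *\<^sub>R v k"
    have "p \<in> ball z e" using vk ze(1) by (simp add: p_def dist_norm)
    then have "v k \<bullet> p \<le> x $ k" using ze(2) by (auto simp: poly_P_def)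
    moreover have "v k \<bullet> p = v k \<bullet> z + e / 2 * norm (v k)"
      using vk by (simp add: p_def inner_add_right dot_square_norm power2_eq_square)
    moreover have "e / 2 * norm (v k) > 0" using vk ze(1) by simp
    ultimately show ?thesis by linarith
  qed
  with ze show ?thesis by (rule that)
qed

text \<open>If all \<open>v k \<bullet> p\<close> are at most \<open>B\<close>, then
  \<open>p\<close> scaled by \<open>\<delta> / B\<close> can be added to an interior point
  \<open>z\<close> with slack \<open>\<delta>\<close> without leaving the polytope, whose radius
  \<open>R\<close> then bounds \<open>p\<close>.\<close>

lemma outer_facet_normals_normal_system:
  fixes v :: "'n::finite \<Rightarrow> real^'d"
  assumes N: "has_outer_facet_normals v x"
  obtains C where "normal_system v C"
proof -
  obtain z e where z: "\<And>k. v k \<bullet> z < x $ k"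
    using outer_facet_normals_interior[OF N] by blast
  define \<delta> where "\<delta> = Min (range (\<lambda>k. x $ k - v k \<bullet> z))"
  have d: "\<delta> > 0" unfolding \<delta>_def using z by (subst Min_gr_iff) auto
  have dk: "v k \<bullet> z + \<delta> \<le> x $ k" for k
  proof -
    have "\<delta> \<le> x $ k - v k \<bullet> z" unfolding \<delta>_def by (rule Min_le) auto
    then show ?thesis by linarith
  qed
  have "bounded (poly_P v x)"
    using N by (simp add: has_outer_facet_normals_def polytope_imp_bounded)
  then obtain R where R: "\<And>p. p \<in> poly_P v x \<Longrightarrow> norm p \<le> R" unfolding bounded_iff by blast
  have bound: "norm p \<le> (R + norm z) / \<delta> * B" if B: "B > 0" and p: "\<And>k. v k \<bullet> p \<le> B" for p B
  proof -
    have "z + (\<delta> / B) *\<^sub>R p \<in> poly_P v x"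
      unfolding poly_P_def
    proof safe
      fix k
      have "\<delta> / B * (v k \<bullet> p) \<le> \<delta> / B * B" using p[of k] d B by (intro mult_left_mono) auto
      then show "v k \<bullet> (z + (\<delta> / B) *\<^sub>R p) \<le> x $ k" using dk[of k] B by (simp add: inner_add_right)
    qed
    from R[OF this] have "norm ((\<delta> / B) *\<^sub>R p) \<le> R + norm z"
      using norm_triangle_ineq4[of "z + (\<delta> / B) *\<^sub>R p" z] by simp
    then have "\<delta> / B * norm p \<le> R + norm z" using d B by simp
    then show ?thesis using d B by (simp add: field_simps)
  qed
  have "normal_system v ((R + norm z) / \<delta>)"
  proof
    show "v i \<noteq> 0" for i using N by (simp add: has_outer_facet_normals_def)
  qed (rule bound)
  then show ?thesis by (rule that)
qed

text \<open>A degenerate relation is excluded by the signs of its coefficients. Nonnegative ones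
  contradict \<open>facet_not_combination\<close>; nonpositive ones contradict the interior point
  \<open>z\<close>; for mixed signs the relation is solved for the constraint with positive
  coefficient, which is then a nonnegative combination of the other two.\<close>

lemma (in normal_system) outer_facet_normals_regular:
  assumes N: "has_outer_facet_normals v x"
  shows "regular x"
proof -
  obtain z where z: "\<And>k. v k \<bullet> z < x $ k"
    using outer_facet_normals_interior[OF N] by blast
  note comb = facet_not_combination[OF N]
  have "slice_nondeg j x" for j
    unfolding slice_nondeg_def
  proof (intro allI impI notI)
    fix k a assume k: "k \<noteq> j" "v k = a *\<^sub>R v j" "x $ k = a * x $ j"
    show False
    proof (cases "a \<ge> 0")
      case True
      then show False using comb[of k j j a 0] k by simp
    next
      case False
      then have "a * x $ j \<le> a * (v j \<bullet> z)" using z[of j] by (intro mult_left_mono_neg) auto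
      then show False using z[of k] k by simp
    qed
  qed
  moreover have "slice2_nondeg i j x" if ij: "i \<noteq> j" for i j
    unfolding slice2_nondeg_def
  proof (intro allI impI notI)
    fix k a c
    assume k: "k \<noteq> i" "k \<noteq> j" and vk: "v k = a *\<^sub>R v i + c *\<^sub>R v j" and xk: "x $ k = a * x $ i + c * x $ j"
    consider "a \<ge> 0" "c \<ge> 0" | "a \<le> 0" "c \<le> 0" | "a > 0" "c < 0" | "a < 0" "c > 0" by linarith
    then show False
    proof cases
      case 1
      then show False using comb[OF k vk xk] by blast
    next
      case 2
      then have "a * x $ i \<le> a * (v i \<bullet> z)" "c * x $ j \<le> c * (v j \<bullet> z)"
        using z[of i] z[of j] by (auto intro!: mult_left_mono_neg)
      then show False using z[of k] vk xk by (simp add: inner_add_left)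
    next
      case 3
      have e1: "v i = (1 / a) *\<^sub>R v k + (- c / a) *\<^sub>R v j"
        using 3 by (simp add: vk scaleR_add_right)
      have e2: "x $ i = (1 / a) * x $ k + (- c / a) * x $ j"
        using 3 by (simp add: xk field_simps)
      show False
        by (rule comb[OF _ _ e1 e2]) (use k ij 3 in \<open>auto simp: divide_nonpos_pos\<close>)
    next
      case 4
      have e1: "v j = (1 / c) *\<^sub>R v k + (- a / c) *\<^sub>R v i"
        using 4 by (simp add: vk scaleR_add_right)
      have e2: "x $ j = (1 / c) * x $ k + (- a / c) * x $ i"
        using 4 by (simp add: xk field_simps)
      show False
        by (rule comb[OF _ _ e1 e2]) (use k ij 4 in \<open>auto simp: divide_nonpos_pos\<close>)
    qed
  qed
  ultimately show ?thesis unfolding regular_def by blast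
qed

lemma outer_facet_normals_measure_pos:
  fixes v :: "'n::finite \<Rightarrow> real^'d"
  assumes N: "has_outer_facet_normals v x"
  shows "measure lebesgue (poly_P v x) > 0"
proof -
  obtain z e where ze: "e > 0" "ball z e \<subseteq> poly_P v x"
    by (rule outer_facet_normals_interior[OF N]) (rule that)
  have "compact (poly_P v x)"
    using N by (simp add: has_outer_facet_normals_def polytope_imp_compact)
  then have "measure lebesgue (ball z e) \<le> measure lebesgue (poly_P v x)"
    using ze(2) by (intro measure_mono_fmeasurable lmeasurable_compact) auto
  moreover have "measure lebesgue (ball z e) = measure lborel (ball z e)"
    by (rule measure_completion) simp
  ultimately show ?thesis using content_ball_pos[OF ze(1), of z] by linarith
qed

text \<open>For \<open>x = 0\<close> the polyhedron is a cone, and an interior point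
  \<open>z\<close> satisfies the premise of \<open>norm_bound\<close> for every
  \<open>B > 0\<close>. The \<open>B\<close> chosen below would give \<open>norm z\<close> at most
  half of itself.\<close>

lemma (in normal_system) outer_facet_normals_nonzero:
  assumes N: "has_outer_facet_normals v x"
  shows "x \<noteq> 0"
proof
  assume "x = 0"
  then obtain z where z: "\<And>k. v k \<bullet> z < 0"
    using outer_facet_normals_interior[OF N] by (metis zero_index)
  then have nz: "norm z > 0" by (metis inner_zero_right less_irrefl zero_less_norm_iff)
  define B where "B = norm z / (2 * (\<bar>C\<bar> + 1))"
  have "B > 0" using nz by (simp add: B_def add_nonneg_pos)
  then have "norm z \<le> C * B" using z by (intro norm_bound) (auto intro: less_imp_le less_trans)
  also have "\<dots> \<le> (\<bar>C\<bar> + 1) * B" using \<open>B > 0\<close> by (intro mult_right_mono) auto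
  also have "\<dots> = norm z / 2" by (simp add: B_def field_simps)
  finally show False using nz by simp
qed

text \<open>Every isometric parametrisation of the facet extends, by the unit normal, to an orthonormal
  frame of the whole space; there the facet volume is a derivative of the volume. Hence all
  parametrisations give the same value.\<close>

lemma (in normal_system) facet_parametrisation_volume:
  fixes b :: "nat \<Rightarrow> real^'d"
  assumes facet: "aff_dim (face_F v j x) = int m" and card: "CARD('d) = Suc m"
    and nd: "slice_nondeg j x"
    and b: "orthonormal_frame m b" and sub: "face_F v j x \<subseteq> range (flat_point m a b)"
  shows "measure (coord_lborel m) {y \<in> space (coord_lborel m). flat_point m a b y \<in> face_F v j x}
     = norm (v j) * gradvol j x"
proof -
  have nj: "norm (v j) > 0" using nonzero by simp
  let ?W = "span (b ` {..<m})" and ?H = "{p. v j \<bullet> p = x $ j}"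
  have "range (flat_point m a b) \<subseteq> (+) a ` ?W"
    unfolding flat_point_def by (intro image_subsetI imageI span_sum span_scale) (auto intro: span_base)
  with sub have FW: "face_F v j x \<subseteq> (+) a ` ?W" by blast
  have affW: "affine ((+) a ` ?W)" by (intro affine_translation[THEN iffD1] subspace_imp_affine subspace_span)
  have "aff_dim ((+) a ` ?W) = int (dim (b ` {..<m}))"
    by (simp add: aff_dim_translation_eq aff_dim_subspace)
  also have "dim (b ` {..<m}) = m"
    using dim_eq_card_independent[OF orthonormal_frameD(4)[OF b]] card_image[OF orthonormal_frameD(1)[OF b]] by simp
  finally have dimW: "aff_dim ((+) a ` ?W) = int m" .
  \<comment> \<open>By equality of dimensions the facet spans the whole flat, so the flat lies in
    the hyperplane of \<open>j\<close> and all directions \<open>b l\<close> with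
    \<open>l < m\<close> are orthogonal to \<open>v j\<close>.\<close>
  have "affine hull face_F v j x = (+) a ` ?W"
  proof (rule affine_dim_equal)
    show "affine hull face_F v j x \<noteq> {}" using facet by auto
    show "affine hull face_F v j x \<subseteq> (+) a ` ?W" by (rule hull_minimal[where S=affine, OF FW affW])
  qed (use affW dimW facet in auto)
  moreover have "affine hull face_F v j x \<subseteq> ?H"
    by (rule hull_minimal) (auto simp: face_F_def affine_hyperplane)
  ultimately have H: "v j \<bullet> (a + w) = x $ j" if "w \<in> ?W" for w using that by blast
  have ja: "v j \<bullet> a = x $ j" using H[OF span_zero] by simp
  have jb: "v j \<bullet> b l = 0" if "l < m" for l
    using H[OF span_base[of "b l"]] that ja by (simp add: inner_add_right)
  define b' where "b' = b(m := v j /\<^sub>R norm (v j))"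
  have b': "orthonormal_frame (Suc m) b'"
  proof -
    have "(v j /\<^sub>R norm (v j)) \<bullet> (v j /\<^sub>R norm (v j)) = 1"
      using nj by (simp add: dot_square_norm power2_eq_square)
    then show ?thesis
      using b jb by (auto simp: orthonormal_frame_def b'_def less_Suc_eq inner_commute)
  qed
  have vj: "v j = norm (v j) *\<^sub>R b' m" using nj by (simp add: b'_def)
  define r where "r = x $ j / norm (v j)"
  \<comment> \<open>\<open>facet_vol\<close> measures from the foot \<open>r *\<^sub>R b' m\<close>
    of the perpendicular, the parametrisation from \<open>a\<close>. Translating by the difference
    \<open>a'\<close>, which is orthogonal to \<open>v j\<close>, aligns the two and leaves bound
    \<open>j\<close> unchanged.\<close>
  define a' where "a' = a - r *\<^sub>R b' m"
  have ja': "v j \<bullet> a' = 0"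
    using ja frame_normal(1)[OF card b' vj] nj by (simp add: a'_def r_def inner_diff_right)
  define y where "y = x - (\<chi> k. v k \<bullet> a')"
  have yj: "y $ j = x $ j" by (simp add: y_def ja')
  have "vol (y + t *\<^sub>R axis j 1) = vol (x + t *\<^sub>R axis j 1)" for t
    using measure_poly_P_translate[of v "y + t *\<^sub>R axis j 1" a'] by (simp add: y_def algebra_simps)
  then have "gradvol j x = gradvol j y" by (simp add: partial_deriv_def)
  moreover have "slice_nondeg j y"
    unfolding slice_nondeg_def
  proof (intro allI impI)
    fix k s assume k: "k \<noteq> j" "v k = s *\<^sub>R v j"
    then have "y $ k = x $ k" by (simp add: y_def ja')
    then show "y $ k \<noteq> s * y $ j" using nd k yj unfolding slice_nondeg_def by auto
  qed
  then have "gradvol j y = facet_vol m b' j y / norm (v j)"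
    by (rule gradvol_eq_facet_vol[OF card b' vj])
  ultimately have "norm (v j) * gradvol j x = facet_vol m b' j y" using nj by simp
  also have "\<dots> = measure (coord_lborel m) {q \<in> space (coord_lborel m). flat_point m a b q \<in> face_F v j x}"
  proof -
    have bound: "y $ k - v k \<bullet> b' m / norm (v j) * y $ j = x $ k - v k \<bullet> a" for k
      unfolding yj by (simp add: y_def a'_def r_def inner_diff_right)
    have "flat_point m a b q \<in> face_F v j x \<longleftrightarrow> (\<forall>k\<in>UNIV - {j}. (\<Sum>l<m. v k \<bullet> b' l * q l) \<le> x $ k - v k \<bullet> a)" for q
    proof -
      have s: "v k \<bullet> flat_point m a b q = v k \<bullet> a + (\<Sum>l<m. v k \<bullet> b' l * q l)" for k
        by (simp add: flat_point_def inner_add_right inner_sum_right b'_def mult.commute)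
      have "v j \<bullet> flat_point m a b q = x $ j"
        unfolding s using ja jb by (simp add: b'_def)
      then show ?thesis unfolding face_F_def poly_P_def by (auto simp: s algebra_simps)
    qed
    then show ?thesis unfolding facet_vol_def ineq_vol_def ineq_set_def bound by simp
  qed
  finally show ?thesis by simp
qed

text \<open>The choice in \<open>flat_volume\<close> is harmless once some parametrisation exists,
  here one based at the foot of the perpendicular from the origin, and every parametrisation gives
  the same value.\<close>

lemma (in normal_system) flat_volume_facet:
  assumes N: "has_outer_facet_normals v x"
  shows "flat_volume (CARD('d) - 1) (face_F v j x) = norm (v j) * gradvol j x"
proof -
  obtain m where card: "CARD('d) = Suc m" by (rule card_Suc)
  have facet: "aff_dim (face_F v j x) = int m"
    using N card by (simp add: has_outer_facet_normals_def facet_of_def)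
  have nd: "slice_nondeg j x" using outer_facet_normals_regular[OF N] by (simp add: regular_def)
  obtain b where b: "orthonormal_frame (Suc m) b" "v j = norm (v j) *\<^sub>R b m"
    using orthonormal_frame_last[OF nonzero, of m j] card by auto
  let ?a = "(x $ j / norm (v j)) *\<^sub>R b m"
  have "face_F v j x \<subseteq> range (flat_point m ?a b)"
  proof
    fix p assume "p \<in> face_F v j x"
    then have "v j \<bullet> p = x $ j" by (simp add: face_F_def)
    moreover have "v j \<bullet> p = norm (v j) * (p \<bullet> b m)" by (subst b(2)) (simp add: inner_commute)
    ultimately have "p \<bullet> b m = x $ j / norm (v j)" using nonzero[of j] by (simp add: field_simps)
    then have "p = flat_point m ?a b (\<lambda>l. p \<bullet> b l)"
      using frame_expand[OF card b, of p] by (simp add: flat_point_def add.commute)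
    then show "p \<in> range (flat_point m ?a b)" by blast
  qed
  moreover have "orthonormal_frame m b" using b(1) by (rule orthonormal_frame_mono) simp
  ultimately have ex: "\<exists>\<mu> a b. orthonormal_frame m b \<and> face_F v j x \<subseteq> range (flat_point m a b) \<and>
     \<mu> = measure (coord_lborel m) {y \<in> space (coord_lborel m). flat_point m a b y \<in> face_F v j x}"
    by blast
  have "flat_volume m (face_F v j x) = norm (v j) * gradvol j x"
    unfolding flat_volume_def
    by (rule someI2_ex[OF ex]) (use facet_parametrisation_volume[OF facet card nd] in auto)
  then show ?thesis by (simp add: card)
qed

theorem theorem3p2:
  fixes v :: "'n::finite \<Rightarrow> real^'d" and x0 :: "real^'n"
    and M :: "real^'n^'n" and lam1 :: real
  assumes dim: "CARD('d) \<ge> 2"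
    and normals: "has_outer_facet_normals v x0"
    and M: "\<And>i j. M $ i $ j =
        - partial_deriv i (partial_deriv j (\<lambda>x. measure lebesgue (poly_P v x))) x0"
    and lam1: "lam1 < 0" "is_simple_eigenvalue M lam1"
    and lam1_unique: "\<And>l. l < 0 \<Longrightarrow> is_eigenvalue M l \<Longrightarrow> l = lam1"
  shows "lam1 \<le> - (real CARD('d) * (real CARD('d) - 1) *
                    (measure lebesgue (poly_P v x0) / (norm x0)\<^sup>2)) \<and>
         (lam1 = - (real CARD('d) * (real CARD('d) - 1) *
                    (measure lebesgue (poly_P v x0) / (norm x0)\<^sup>2)) \<longleftrightarrow>
          (\<exists>c. \<forall>i. x0 $ i = c * (flat_volume (CARD('d) - 1) (face_F v i x0) / norm (v i))))"
proof -
  obtain C where "normal_system v C" by (rule outer_facet_normals_normal_system[OF normals])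
  then interpret normal_system v C .
  let ?d = "real CARD('d)"
  define G where "G = (\<chi> i. gradvol i x0)"
  have regular: "regular x0" by (rule outer_facet_normals_regular[OF normals])
  have G_flat: "flat_volume (CARD('d) - 1) (face_F v i x0) / norm (v i) = G $ i" for i
    unfolding flat_volume_facet[OF normals] G_def using nonzero[of i] by simp
  have vol: "vol x0 > 0" by (rule outer_facet_normals_measure_pos[OF normals])
  have x0: "x0 \<noteq> 0" by (rule outer_facet_normals_nonzero[OF normals])
  then have nx0: "(norm x0)\<^sup>2 > 0" by simp
  have sym: "transpose M = M"
    using hessian_symmetric[OF regular] by (simp add: vec_eq_iff transpose_def M)
  have Mx0: "M *v x0 = (- (?d - 1)) *\<^sub>R G"
  proof -
    have "(M *v x0) $ i = (- (?d - 1)) * G $ i" for i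
    proof -
      have "(M *v x0) $ i = - (\<Sum>j\<in>UNIV. x0 $ j * partial_deriv i (gradvol j) x0)"
        by (simp add: matrix_vector_mult_def M sum_negf mult.commute)
      then show ?thesis unfolding euler_gradvol[OF regular] by (simp add: G_def algebra_simps)
    qed
    then show ?thesis by (simp add: vec_eq_iff)
  qed
  have xMx: "x0 \<bullet> (M *v x0) = - (?d * (?d - 1) * vol x0)"
  proof -
    have "x0 \<bullet> G = ?d * vol x0"
      using euler_vol[of x0] regular by (simp add: regular_def inner_vec_def G_def mult.commute)
    then show ?thesis by (simp add: Mx0 algebra_simps)
  qed
  obtain l where l: "is_eigenvalue M l" "\<And>p. p \<bullet> (M *v p) \<ge> l * (p \<bullet> p)"
    using symmetric_matrix_least_eigenvalue[OF sym] by blast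
  \<comment> \<open>As a lower bound of the Rayleigh quotient, \<open>l\<close> lies below every
    eigenvalue; being at most \<open>lam1\<close> it is negative, and uniqueness identifies the
    two.\<close>
  have "l \<le> lam1"
  proof -
    obtain w where w: "w \<noteq> 0" "M *v w = lam1 *\<^sub>R w"
      using lam1(2) unfolding is_simple_eigenvalue_def is_eigenvalue_def by blast
    then have "l * (w \<bullet> w) \<le> lam1 * (w \<bullet> w)" using l(2)[of w] by simp
    then show ?thesis using w(1) by simp
  qed
  then have "l = lam1" using lam1_unique l(1) lam1(1) by simp
  then have min: "p \<bullet> (M *v p) \<ge> lam1 * (p \<bullet> p)" for p using l(2) by simp
  have rhs: "?d * (?d - 1) * (vol x0 / (norm x0)\<^sup>2) = - (x0 \<bullet> (M *v x0)) / (norm x0)\<^sup>2"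
    unfolding xMx by simp
  have le: "lam1 \<le> - (?d * (?d - 1) * (vol x0 / (norm x0)\<^sup>2))"
    using min[of x0] nx0 unfolding rhs by (simp add: field_simps dot_square_norm)
  have "lam1 = - (?d * (?d - 1) * (vol x0 / (norm x0)\<^sup>2)) \<longleftrightarrow> (\<exists>c. \<forall>i. x0 $ i = c * G $ i)"
  proof
    assume "lam1 = - (?d * (?d - 1) * (vol x0 / (norm x0)\<^sup>2))"
    then have attained: "x0 \<bullet> (M *v x0) = lam1 * (x0 \<bullet> x0)"
      using nx0 unfolding rhs by (simp add: field_simps dot_square_norm)
    define N where "N = M - lam1 *\<^sub>R mat 1"
    have N: "N *v p = M *v p - lam1 *\<^sub>R p" for p
      by (simp add: N_def matrix_vector_mult_diff_rdistrib scaleR_matrix_vector_assoc[symmetric])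
    \<comment> \<open>Equality means that \<open>x0\<close> attains the minimum of the Rayleigh
      quotient, so it is an eigenvector for \<open>lam1\<close>; comparison with \<open>Mx0\<close>
      yields the proportionality.\<close>
    have "N *v x0 = 0"
    proof (rule psd_form_zero_imp_kernel)
      show "transpose N = N" using sym by (simp add: N_def vec_eq_iff transpose_def mat_def)
      show "p \<bullet> (N *v p) \<ge> 0" for p using min[of p] by (simp add: N inner_diff_right)
      show "x0 \<bullet> (N *v x0) = 0" using attained by (simp add: N inner_diff_right)
    qed
    then have "lam1 *\<^sub>R x0 = (- (?d - 1)) *\<^sub>R G" using Mx0 by (simp add: N)
    then have "lam1 * x0 $ i = - (?d - 1) * G $ i" for i
      by (metis vector_scaleR_component real_scaleR_def)
    then have "x0 $ i = (- (?d - 1) / lam1) * G $ i" for i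
      using lam1(1) by (simp add: field_simps)
    then show "\<exists>c. \<forall>i. x0 $ i = c * G $ i" by blast
  next
    assume "\<exists>c. \<forall>i. x0 $ i = c * G $ i"
    then obtain c where c: "x0 = c *\<^sub>R G" by (auto simp: vec_eq_iff)
    then have "c \<noteq> 0" using x0 by auto
    define \<mu> where "\<mu> = - (?d - 1) / c"
    have ev: "M *v x0 = \<mu> *\<^sub>R x0" unfolding Mx0 using \<open>c \<noteq> 0\<close> by (subst c) (simp add: \<mu>_def)
    then have \<mu>: "\<mu> = (x0 \<bullet> (M *v x0)) / (norm x0)\<^sup>2" using x0 by (simp add: dot_square_norm)
    \<comment> \<open>The sign of \<open>c\<close> is unknown, so negativity of the eigenvalue
      \<open>\<mu>\<close> is read off the Rayleigh quotient at \<open>x0\<close>; here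
      \<open>dim\<close> makes \<open>?d - 1\<close> positive. Uniqueness then gives
      \<open>\<mu> = lam1\<close>.\<close>
    have "?d * (?d - 1) * vol x0 > 0" using dim vol by simp
    then have "\<mu> < 0" unfolding \<mu> xMx using nx0 by (simp add: divide_neg_pos)
    moreover have "is_eigenvalue M \<mu>" using ev x0 unfolding is_eigenvalue_def by blast
    ultimately have "\<mu> = lam1" by (rule lam1_unique)
    then show "lam1 = - (?d * (?d - 1) * (vol x0 / (norm x0)\<^sup>2))" using \<mu> unfolding rhs by simp
  qed
  with le show ?thesis unfolding G_flat by blast
qed

end
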